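(* As power series in $q$, \[ \sum_{n=0}^\infty \mathcal{EO}_u(10n+4)q^n =3\,\frac{ f_2^4f_5^6}{f_1^8 f_{10}^2}+8q\,\frac{f_2^3 f_5f_{10}^3}{f_1^7}. \]
   Context: For a positive integer $k$, let $f_k:=(q^k;q^k)_\infty=\prod_{i=1}^\infty(1-q^{ki})$. The integers $\mathcal{EO}_u(n)$, $n\ge 0$, are defined by $\sum_{n=0}^\infty \mathcal{EO}_u(n)q^n=\dfrac{f_4^2}{f_2^2}$. *)

theory Defs
  imports "HOL-Analysis.Analysis"
begin

text \<open>
  The infinite product is taken in the topology on formal power series, where it converges for
  \<open>k > 0\<close> (\<open>euler_f_has_prod\<close>); the index \<open>i\<close> starts at 0, hence the \<open>Suc i\<close>. Rational
  coefficients are used so that \<open>/\<close> on power series is the library's division.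
\<close>

definition euler_f :: "nat \<Rightarrow> rat fps" where
  "euler_f k = (\<Prod>i. 1 - fps_X ^ (k * Suc i))"

definition EO_u :: "nat \<Rightarrow> rat" where
  "EO_u n = fps_nth (euler_f 4 ^ 2 / euler_f 2 ^ 2) n"

lemma partial_prod_stable:
  assumes "k > 0" "n \<ge> m"
  shows "fps_nth (\<Prod>i\<le>n. 1 - fps_X ^ (k * Suc i) :: rat fps) m
       = fps_nth (\<Prod>i\<le>m. 1 - fps_X ^ (k * Suc i)) m"
  using assms(2)
proof (induction n rule: dec_induct)
  case base
  show ?case ..
next
  case (step n)
  have "m < Suc (Suc n)" using step by simp
  also have "\<dots> \<le> k * Suc (Suc n)" using assms(1) by (cases k) auto
  finally have "m < k * Suc (Suc n)" .
  then show ?case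
    using step.IH by (simp add: right_diff_distrib fps_X_power_mult_right_nth del: mult_Suc_right)
qed

lemma partial_prod_nth_0:
  assumes "k > 0"
  shows "fps_nth (\<Prod>i\<le>(0::nat). 1 - fps_X ^ (k * Suc i) :: rat fps) 0 = 1"
  using assms by simp

lemma euler_f_aux:
  assumes "k > 0"
  defines "L \<equiv> Abs_fps (\<lambda>m. fps_nth (\<Prod>i\<le>m. 1 - fps_X ^ (k * Suc i) :: rat fps) m)"
  shows "(\<lambda>i. 1 - fps_X ^ (k * Suc i)) has_prod L"
proof -
  have "(\<lambda>n. \<Prod>i\<le>n. 1 - fps_X ^ (k * Suc i) :: rat fps) \<longlonglongrightarrow> L"
  proof (rule tendsto_fpsI)
    fix m
    show "\<forall>\<^sub>F n in sequentially. fps_nth (\<Prod>i\<le>n. 1 - fps_X ^ (k * Suc i)) m = fps_nth L m"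
      using eventually_ge_at_top[of m]
      by eventually_elim (simp only: L_def fps_nth_Abs_fps, rule partial_prod_stable[OF assms(1)])
  qed
  moreover have "fps_nth L 0 = 1"
    using partial_prod_nth_0[OF assms(1)] by (simp add: L_def)
  then have "L \<noteq> 0" by auto
  ultimately show ?thesis
    by (simp add: has_prod_def raw_has_prod_def)
qed

lemma euler_f_nth:
  assumes "k > 0"
  shows "fps_nth (euler_f k) m = fps_nth (\<Prod>i\<le>m. 1 - fps_X ^ (k * Suc i)) m"
  unfolding euler_f_def has_prod_unique[OF euler_f_aux[OF assms], symmetric]
  by (rule fps_nth_Abs_fps)

lemma euler_f_has_prod:
  assumes "k > 0"
  shows "(\<lambda>i. 1 - fps_X ^ (k * Suc i)) has_prod euler_f k"
  unfolding euler_f_def has_prod_unique[OF euler_f_aux[OF assms], symmetric]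
  by (rule euler_f_aux[OF assms])

lemma euler_f_nth_0: "k > 0 \<Longrightarrow> fps_nth (euler_f k) 0 = 1"
  using partial_prod_nth_0[of k] by (simp add: euler_f_nth)

lemma fps_mult_Ints:
  fixes f g :: "rat fps"
  assumes "\<And>n. fps_nth f n \<in> \<int>" "\<And>n. fps_nth g n \<in> \<int>"
  shows "fps_nth (f * g) n \<in> \<int>"
  using assms by (auto simp: fps_mult_nth intro!: Ints_sum)

lemma fps_inverse_Ints:
  fixes f :: "rat fps"
  assumes "\<And>n. fps_nth f n \<in> \<int>" "fps_nth f 0 = 1"
  shows "fps_nth (inverse f) n \<in> \<int>"
proof (induction n rule: less_induct)
  case (less n)
  show ?case
  proof (cases n)
    case 0
    then show ?thesis using assms by simp
  next
    case (Suc m)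
    have "fps_nth f i * fps_nth (inverse f) (Suc m - i) \<in> \<int>" if "i \<in> {1..Suc m}" for i
      using that less[of "Suc m - i"] assms(1)[of i] Suc by (intro Ints_mult) auto
    then have "(\<Sum>i=1..Suc m. fps_nth f i * fps_nth (inverse f) (Suc m - i)) \<in> \<int>"
      by (rule Ints_sum)
    then show ?thesis
      using assms(2) Suc by (simp add: fps_inverse_def del: sum.cl_ivl_Suc)
  qed
qed

lemma euler_f_Ints:
  assumes "k > 0"
  shows "fps_nth (euler_f k) m \<in> \<int>"
proof -
  have "fps_nth (\<Prod>i\<le>n. 1 - fps_X ^ (k * Suc i) :: rat fps) m \<in> \<int>" for n m
  proof (induction n arbitrary: m)
    case 0
    then show ?case by (auto simp: fps_X_power_nth)
  next
    case (Suc n)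
    show ?case unfolding prod.atMost_Suc
      by (rule fps_mult_Ints) (use Suc in \<open>auto simp: fps_X_power_nth\<close>)
  qed
  then show ?thesis by (simp only: euler_f_nth[OF assms])
qed

lemma EO_u_Ints: "EO_u n \<in> \<int>"
proof -
  have sq: "fps_nth (euler_f k ^ 2) m \<in> \<int>" if "k > 0" for k m
    unfolding power2_eq_square by (rule fps_mult_Ints; rule euler_f_Ints[OF that])
  have one: "fps_nth (euler_f 2 ^ 2) 0 = 1"
    by (simp add: fps_power_zeroth euler_f_nth_0)
  then have "euler_f 4 ^ 2 / euler_f 2 ^ 2 = euler_f 4 ^ 2 * inverse (euler_f 2 ^ 2)"
    by (intro fps_divide_unit) simp
  moreover have "fps_nth (euler_f 4 ^ 2 * inverse (euler_f 2 ^ 2)) n \<in> \<int>"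
  proof (rule fps_mult_Ints)
    show "fps_nth (euler_f 4 ^ 2) m \<in> \<int>" for m by (rule sq) simp
    show "fps_nth (inverse (euler_f 2 ^ 2)) m \<in> \<int>" for m
      by (rule fps_inverse_Ints[OF sq one]) simp
  qed
  ultimately show ?thesis by (simp only: EO_u_def)
qed

end

theory Submission
  imports Defs "HOL-Computational_Algebra.Formal_Laurent_Series"
begin

text \<open>
  Replacing \<open>q^2\<close> by \<open>q\<close>, one needs the coefficients of \<open>q^(5n+2)\<close> in \<open>f_2^2 / f_1^2 = \<psi>(q) / f_1\<close>, where
  \<open>\<psi>(q) = f_2^2 / f_1\<close>. Jacobi's triple product turns \<open>\<psi>\<close>, \<open>f_1\<close> and the products of level 5 and 10 into theta series,
  so that both 5-dissections can be read off from exponents modulo 5. In the dissection of \<open>f_1\<close> the three parts are in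
  geometric progression, up to sign, hence \<open>1 / f_1\<close> is a polynomial in them divided by a norm, which is a series in
  \<open>q^5\<close>. This gives the section as a polynomial in theta series. It is simplified with six quadratic theta relations,
  each proved by a linear change of the two summation indices, which express all quotients involved as rational
  functions of one parameter \<open>K\<close>; the claim becomes an identity of rational functions.
\<close>

section \<open>Generating series of weighted sets\<close>

text \<open>The norm can be written down because the parts form a geometric progression. If they are
  e0, -q e1 and -q^2 e2 with e0 e2 = e1^2, then f_1 = e0 (1 - y - y^2) with y = q e1 / e0, and the
  product over the five conjugates is e0^5 (1 - 11 y^5 - y^10), where 11 is the fifth Lucas number.
  Once q^5 is replaced by q, this norm equals f_1^6 / f_5, Ramanujan's evaluation of 1/R^5 - 11 -
  R^5; hence the high powers of f_1 in the denominators of the claim. The obstacle is that the parts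
  themselves are products over selected residue classes modulo 5 and 10, not products of f_k. Only
  their combination is expected to be expressible by the f_k, and the parameter \<open>K\<close> is
  what makes the individual terms comparable.\<close>

definition gen_series :: "('a \<Rightarrow> rat) \<Rightarrow> ('a \<Rightarrow> rat) \<Rightarrow> rat fps" where
  "gen_series w e = Abs_fps (\<lambda>n. \<Sum>x | e x = of_nat n. w x)"

text \<open>A sum over an infinite fibre would silently be 0, so multiplying and splitting series
  require this condition.\<close>

definition finite_fibres :: "('a \<Rightarrow> rat) \<Rightarrow> bool" where
  "finite_fibres e \<longleftrightarrow> (\<forall>n::nat. finite {x. e x = of_nat n})"

lemma gen_series_nth: "fps_nth (gen_series w e) n = (\<Sum>x | e x = of_nat n. w x)"
  by (simp add: gen_series_def)

lemma gen_series_reindex: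
  assumes "bij h" "\<And>x. v x = w (h x)" "\<And>x. d x = e (h x)"
  shows "gen_series v d = gen_series w e"
proof (rule fps_ext)
  fix n
  have "bij_betw h {x. e (h x) = of_nat n} {x. e x = of_nat n}"
  proof (rule bij_betw_imageI)
    show "inj_on h {x. e (h x) = of_nat n}"
      using bij_is_inj[OF assms(1)] by (rule inj_on_subset) simp
    show "h ` {x. e (h x) = of_nat n} = {x. e x = of_nat n}"
    proof (intro equalityI subsetI)
      fix y assume y: "y \<in> {x. e x = of_nat n}"
      obtain x where "y = h x" using bij_is_surj[OF assms(1)] by (rule surjE)
      with y show "y \<in> h ` {x. e (h x) = of_nat n}" by blast
    qed auto
  qed
  from sum.reindex_bij_betw[OF this, of w]
  show "fps_nth (gen_series v d) n = fps_nth (gen_series w e) n"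
    unfolding gen_series_nth assms(2,3) .
qed

lemma gen_series_scale: "gen_series (\<lambda>x. c * w x) e = fps_const c * gen_series w e"
  by (rule fps_ext) (simp add: gen_series_nth sum_distrib_left)

lemma gen_series_antisymmetric:
  assumes "bij h" "\<And>x. w (h x) = - w x" "\<And>x. e (h x) = e x"
  shows "gen_series w e = 0"
proof -
  have "gen_series (\<lambda>x. (- 1) * w x) e = gen_series w e"
    by (rule gen_series_reindex[OF assms(1)]) (simp_all add: assms)
  then have "gen_series w e = - gen_series w e"
    unfolding gen_series_scale by (simp add: fps_const_neg[symmetric] del: fps_const_neg)
  then have "2 * gen_series w e = 0" by simp
  then show ?thesis by simp
qed

lemma gen_series_shift:
  assumes "\<And>x. e x \<in> \<nat>"
  shows "gen_series w (\<lambda>x. e x + of_nat k) = fps_X ^ k * gen_series w e"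
proof (rule fps_ext)
  fix n
  have "{x. e x + of_nat k = of_nat n} = (if n < k then {} else {x. e x = of_nat (n - k)})"
  proof (cases "n < k")
    case True
    have "e x + of_nat k \<noteq> of_nat n" for x
    proof -
      obtain m where m: "e x = of_nat m" using assms[of x] by (auto elim: Nats_cases)
      show ?thesis unfolding m of_nat_add[symmetric] of_nat_eq_iff using True by simp
    qed
    with True show ?thesis by auto
  qed (auto simp: of_nat_diff)
  then show "fps_nth (gen_series w (\<lambda>x. e x + of_nat k)) n = fps_nth (fps_X ^ k * gen_series w e) n"
    by (simp add: gen_series_nth fps_X_power_mult_nth)
qed

text \<open>Since both exponents are natural numbers, a fibre of their sum is a finite disjoint
  union of rectangles, one for each way of writing n as i + (n - i).\<close>

lemma gen_series_mult:
  assumes "\<And>x. e x \<in> \<nat>" "\<And>x. d x \<in> \<nat>" "finite_fibres e" "finite_fibres d"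
  shows "gen_series w e * gen_series v d = gen_series (\<lambda>(x, y). w x * v y) (\<lambda>(x, y). e x + d y)"
    and "finite_fibres (\<lambda>(x, y). e x + d y)"
proof -
  have eq: "{z. (\<lambda>(x, y). e x + d y) z = of_nat n} =
    (\<Union>i\<in>{0..n}. {x. e x = of_nat i} \<times> {y. d y = of_nat (n - i)})" (is "?L n = ?R n") for n
  proof
    show "?L n \<subseteq> ?R n"
    proof
      fix z assume z: "z \<in> ?L n"
      obtain x y where [simp]: "z = (x, y)" by (cases z)
      obtain i where i: "e x = of_nat i" using assms(1)[of x] by (auto elim: Nats_cases)
      obtain j where j: "d y = of_nat j" using assms(2)[of y] by (auto elim: Nats_cases)
      have "i + j = n" using z by (simp add: i j flip: of_nat_add)
      then have "i \<in> {0..n}" "z \<in> {x. e x = of_nat i} \<times> {y. d y = of_nat (n - i)}"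
        using i j by auto
      then show "z \<in> ?R n" by (rule UN_I)
    qed
    show "?R n \<subseteq> ?L n" by (auto simp: of_nat_diff)
  qed
  have fin: "finite ({x. e x = of_nat i} \<times> {y. d y = of_nat (n - i)})" for i n
    using assms(3,4) by (simp add: finite_fibres_def)
  show "finite_fibres (\<lambda>(x, y). e x + d y)"
    unfolding finite_fibres_def eq using fin by blast
  show "gen_series w e * gen_series v d = gen_series (\<lambda>(x, y). w x * v y) (\<lambda>(x, y). e x + d y)"
  proof (rule fps_ext)
    fix n
    have "fps_nth (gen_series w e * gen_series v d) n =
        (\<Sum>i=0..n. \<Sum>(x,y)\<in>{x. e x = of_nat i} \<times> {y. d y = of_nat (n - i)}. w x * v y)"
      by (simp add: fps_mult_nth gen_series_nth sum_product sum.cartesian_product)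
    also have "\<dots> = fps_nth (gen_series (\<lambda>(x, y). w x * v y) (\<lambda>(x, y). e x + d y)) n"
      unfolding gen_series_nth eq by (rule sum.UNION_disjoint[symmetric]) (use fin in \<open>auto simp del: of_nat_diff\<close>)
    finally show "fps_nth (gen_series w e * gen_series v d) n = \<dots>" .
  qed
qed

text \<open>Here \<open>r\<close> picks a coset and \<open>h r\<close> parametrises it. The lemma
  serves both the 5-dissections (residues of one index) and the products of two theta series (cosets
  of a sublattice of the plane).\<close>

lemma gen_series_split:
  assumes bij: "bij_betw (\<lambda>(r, y). h r y) (I \<times> UNIV) UNIV" and "finite I" and fin: "finite_fibres e"
  shows "gen_series w e = (\<Sum>r\<in>I. gen_series (\<lambda>y. w (h r y)) (\<lambda>y. e (h r y)))"
proof (rule fps_ext)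
  fix n
  define S where "S r = {y. e (h r y) = of_nat n}" for r
  have b: "bij_betw (\<lambda>(r, y). h r y) (Sigma I S) {x. e x = of_nat n}"
    using bij
  proof (rule bij_betw_subset)
    show "Sigma I S \<subseteq> I \<times> UNIV" by auto
    have "x \<in> (\<lambda>(r, y). h r y) ` Sigma I S" if "e x = of_nat n" for x
    proof -
      have "x \<in> (\<lambda>(r, y). h r y) ` (I \<times> UNIV)" using bij by (simp add: bij_betw_def)
      then obtain r y where "r \<in> I" "x = h r y" by auto
      with that show ?thesis unfolding S_def by force
    qed
    then show "(\<lambda>(r, y). h r y) ` Sigma I S = {x. e x = of_nat n}"
      by (auto simp: S_def)
  qed
  have "finite (Sigma I S)"
    using b fin by (simp add: finite_fibres_def bij_betw_finite)
  moreover have "S r \<subseteq> snd ` Sigma I S" if "r \<in> I" for r using that by force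
  ultimately have finS: "\<forall>r\<in>I. finite (S r)" by (meson finite_imageI finite_subset)
  have "fps_nth (gen_series w e) n = (\<Sum>(r,y)\<in>Sigma I S. w (h r y))"
    unfolding gen_series_nth using sum.reindex_bij_betw[OF b, of w] by (simp add: case_prod_unfold)
  also have "\<dots> = (\<Sum>r\<in>I. \<Sum>y\<in>S r. w (h r y))"
    using assms(2) finS by (simp add: sum.Sigma)
  also have "\<dots> = fps_nth (\<Sum>r\<in>I. gen_series (\<lambda>y. w (h r y)) (\<lambda>y. e (h r y))) n"
    by (simp add: fps_sum_nth gen_series_nth S_def)
  finally show "fps_nth (gen_series w e) n = \<dots>" .
qed

lemma gen_series_compose:
  assumes "c > 0" "\<And>x. e x \<in> \<nat>"
  shows "gen_series w (\<lambda>x. of_nat c * e x) = gen_series w e oo fps_X ^ c"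
proof (rule fps_ext)
  fix n
  have "{x. of_nat c * e x = of_nat n} = (if c dvd n then {x. e x = of_nat (n div c)} else {})"
  proof (cases "c dvd n")
    case True
    then obtain k where "n = c * k" by (elim dvdE)
    then show ?thesis using assms(1) by simp
  next
    case False
    have "of_nat c * e x \<noteq> of_nat n" for x
    proof -
      obtain m where m: "e x = of_nat m" using assms(2)[of x] by (auto elim: Nats_cases)
      show ?thesis unfolding m of_nat_mult[symmetric] of_nat_eq_iff using False by auto
    qed
    with False show ?thesis by auto
  qed
  then show "fps_nth (gen_series w (\<lambda>x. of_nat c * e x)) n = fps_nth (gen_series w e oo fps_X ^ c) n"
    using assms(1) by (simp add: gen_series_nth fps_nth_compose_X_power)
qed

section \<open>Ramanujan theta series\<close>

text \<open>This is s^n for s = 1 or s = -1, made available for negative n as well.\<close>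

definition parity_sign :: "rat \<Rightarrow> int \<Rightarrow> rat" where
  "parity_sign s n = (if even n then 1 else s)"

text \<open>Rational values make the halving exact, so an index change is checked by plain field
  arithmetic.\<close>

definition theta_exp :: "nat \<Rightarrow> nat \<Rightarrow> int \<Rightarrow> rat" where
  "theta_exp a b n = (of_nat a * of_int (n * (n + 1)) + of_nat b * of_int (n * (n - 1))) / 2"

text \<open>For \<open>s = 1\<close> and \<open>s = - 1\<close> this is Ramanujan's \<open>f (s q\<^sup>a, s q\<^sup>b)\<close>.\<close>

definition theta :: "rat \<Rightarrow> nat \<Rightarrow> nat \<Rightarrow> rat fps" where
  "theta s a b = gen_series (parity_sign s) (theta_exp a b)"

lemma theta_exp_of_int:
  "theta_exp a b n = of_int ((int a * (n * (n + 1)) + int b * (n * (n - 1))) div 2)"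
proof -
  have "2 dvd int a * (n * (n + 1)) + int b * (n * (n - 1))" by (simp)
  then have "of_int (2 * ((int a * (n * (n + 1)) + int b * (n * (n - 1))) div 2))
    = (of_int (int a * (n * (n + 1)) + int b * (n * (n - 1))) :: rat)"
    by simp
  then show ?thesis unfolding theta_exp_def by (simp only: of_int_mult of_int_add of_int_numeral
    of_int_of_nat_eq of_int_diff of_int_1) simp
qed

text \<open>For integers (|n| - 1) (|n| - 2) >= 0, hence n^2 - |n| >= 2 |n| - 2. Besides finite
  fibres, this yields the explicit window of indices used in the triple product.\<close>

lemma theta_exp_ge:
  assumes "a + b > 0"
  shows "of_int (\<bar>n\<bar> - 1) \<le> theta_exp a b n"
proof -
  have tri: "2 * (\<bar>n\<bar> - 1) \<le> n * (n + 1)" "2 * (\<bar>n\<bar> - 1) \<le> n * (n - 1)" for n :: int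
  proof -
    have "\<bar>n\<bar> \<ge> 2 \<or> \<bar>n\<bar> \<le> 1" by linarith
    then have "(\<bar>n\<bar> - 1) * (\<bar>n\<bar> - 2) \<ge> 0"
      by (elim disjE) (simp_all add: mult_nonpos_nonpos)
    then have "3 * \<bar>n\<bar> \<le> n * n + 2" by (simp add: algebra_simps)
    then show "2 * (\<bar>n\<bar> - 1) \<le> n * (n + 1)" "2 * (\<bar>n\<bar> - 1) \<le> n * (n - 1)"
      by (simp_all add: algebra_simps abs_if split: if_splits)
  qed
  have nn: "0 \<le> n * (n + 1)" "0 \<le> n * (n - 1)"
    by (cases "n \<ge> 0"; cases "n \<ge> 1"; auto simp: zero_le_mult_iff)+
  have "2 * (\<bar>n\<bar> - 1) \<le> int a * (n * (n + 1)) + int b * (n * (n - 1))"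
  proof (cases "a > 0")
    case True
    then have "1 * (n * (n + 1)) \<le> int a * (n * (n + 1))" using nn by (intro mult_right_mono) auto
    moreover have "0 \<le> int b * (n * (n - 1))" using nn by simp
    ultimately show ?thesis using tri[of n] by linarith
  next
    case False
    then have "1 * (n * (n - 1)) \<le> int b * (n * (n - 1))" using nn assms by (intro mult_right_mono) auto
    moreover have "0 \<le> int a * (n * (n + 1))" using nn by simp
    ultimately show ?thesis using tri[of n] by linarith
  qed
  then have "\<bar>n\<bar> - 1 \<le> (int a * (n * (n + 1)) + int b * (n * (n - 1))) div 2"
    using zdiv_mono1[of "2 * (\<bar>n\<bar> - 1)" _ 2]
    by (metis nonzero_mult_div_cancel_left zero_neq_numeral zero_less_numeral)
  then show ?thesis unfolding theta_exp_of_int by (simp only: of_int_le_iff)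
qed

lemma theta_exp_Nats: "theta_exp a b n \<in> \<nat>"
proof -
  have "0 \<le> n * (n + 1)" "0 \<le> n * (n - 1)"
    by (cases "n \<ge> 0"; cases "n \<ge> 1"; auto simp: zero_le_mult_iff)+
  then have "0 \<le> (int a * (n * (n + 1)) + int b * (n * (n - 1))) div 2" by simp
  then show ?thesis unfolding theta_exp_of_int by (metis of_int_of_nat_eq of_nat_in_Nats zero_le_imp_eq_int)
qed

lemma theta_exp_bounded:
  assumes "a + b > 0" "theta_exp a b n = of_nat m"
  shows "\<bar>n\<bar> \<le> int m + 1"
proof -
  have "of_int (\<bar>n\<bar> - 1) \<le> (of_int (int m) :: rat)" using theta_exp_ge[OF assms(1), of n] assms(2) by simp
  then show ?thesis unfolding of_int_le_iff by simp
qed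

lemma theta_exp_finite_fibres:
  assumes "a + b > 0"
  shows "finite_fibres (theta_exp a b)"
  unfolding finite_fibres_def
proof
  fix m :: nat
  have "{n. theta_exp a b n = of_nat m} \<subseteq> {- (int m + 1)..int m + 1}"
    using theta_exp_bounded[OF assms] by (fastforce simp: abs_le_iff)
  then show "finite {n. theta_exp a b n = of_nat m}" by (rule finite_subset) simp
qed

lemma bij_int_affine: "u = 1 \<or> u = -1 \<Longrightarrow> bij (\<lambda>n::int. u * n + t)"
  by (rule o_bij[where g = "\<lambda>n. u * (n - t)"]) (auto simp: fun_eq_iff)

text \<open>Recognises one class of a dissection: \<open>u = - 1\<close> reverses the summation,
  \<open>t\<close> recentres it, and \<open>d\<close> is the least exponent of the class.\<close>

lemma gen_series_eq_theta:
  assumes "u = 1 \<or> u = -1"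
    and "\<And>n. w n = c * parity_sign s (u * n + t)"
    and "\<And>n. e n = of_nat d + theta_exp a b (u * n + t)"
  shows "gen_series w e = fps_const c * fps_X ^ d * theta s a b"
proof -
  have "gen_series w e = gen_series (\<lambda>n. c * parity_sign s n) (\<lambda>n. theta_exp a b n + of_nat d)"
    by (rule gen_series_reindex[OF bij_int_affine[OF assms(1)]]) (simp_all add: assms)
  then show ?thesis
    by (simp add: gen_series_scale gen_series_shift[OF theta_exp_Nats] theta_def mult.assoc)
qed

lemma gen_series_eq_theta_mult:
  assumes "u = 1 \<or> u = -1" "u' = 1 \<or> u' = -1" "a + b > 0" "a' + b' > 0"
    and "\<And>j k. w (j, k) = c * (parity_sign s (u * j + t) * parity_sign s' (u' * k + t'))"
    and "\<And>j k. e (j, k) = of_nat d + (theta_exp a b (u * j + t) + theta_exp a' b' (u' * k + t'))"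
  shows "gen_series w e = fps_const c * fps_X ^ d * (theta s a b * theta s' a' b')"
proof -
  note * = theta_exp_Nats theta_exp_Nats theta_exp_finite_fibres[OF assms(3)] theta_exp_finite_fibres[OF assms(4)]
  have "bij (map_prod (\<lambda>n. u * n + t) (\<lambda>n. u' * n + t'))"
    using bij_betw_map_prod[OF bij_int_affine[OF assms(1)] bij_int_affine[OF assms(2)]]
    by (simp add: UNIV_Times_UNIV)
  then have "gen_series w e = gen_series (\<lambda>x. c * (case x of (j, k) \<Rightarrow> parity_sign s j * parity_sign s' k))
      (\<lambda>x. (case x of (j, k) \<Rightarrow> theta_exp a b j + theta_exp a' b' k) + of_nat d)"
    by (rule gen_series_reindex) (auto simp: assms)
  also have "\<dots> = fps_const c * fps_X ^ d * (theta s a b * theta s' a' b')"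
    unfolding gen_series_scale theta_def gen_series_mult(1)[OF *]
    by (subst gen_series_shift) (auto simp: mult.assoc theta_exp_Nats)
  finally show ?thesis .
qed

lemma theta_compose:
  assumes "c > 0"
  shows "theta s a b oo fps_X ^ c = theta s (c * a) (c * b)"
proof -
  have "theta_exp (c * a) (c * b) = (\<lambda>n. of_nat c * theta_exp a b n)"
    by (rule ext) (simp add: theta_exp_def field_simps)
  then show ?thesis unfolding theta_def by (simp only: gen_series_compose[OF assms theta_exp_Nats])
qed

lemma theta_mult_split:
  assumes "a + b > 0" "a' + b' > 0" "finite I"
    and "bij_betw (\<lambda>(r, y). h r y) (I \<times> UNIV) UNIV"
  shows "theta s a b * theta s' a' b' = (\<Sum>r\<in>I. gen_series
    (\<lambda>y. case h r y of (m, n) \<Rightarrow> parity_sign s m * parity_sign s' n)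
    (\<lambda>y. case h r y of (m, n) \<Rightarrow> theta_exp a b m + theta_exp a' b' n))"
proof -
  note * = theta_exp_Nats theta_exp_Nats theta_exp_finite_fibres[OF assms(1)] theta_exp_finite_fibres[OF assms(2)]
  show ?thesis unfolding theta_def gen_series_mult(1)[OF *]
    by (rule gen_series_split[OF assms(4,3) gen_series_mult(2)[OF *]])
qed

section \<open>Infinite products\<close>

text \<open>Congruence modulo q^D.\<close>

definition agree :: "nat \<Rightarrow> rat fps \<Rightarrow> rat fps \<Rightarrow> bool" where
  "agree D f g \<longleftrightarrow> (\<forall>k<D. fps_nth f k = fps_nth g k)"

lemma agree_refl [simp]: "agree D f f" by (simp add: agree_def)

lemma agree_sym: "agree D f g \<Longrightarrow> agree D g f" by (simp add: agree_def)

lemma agree_trans [trans]: "agree D f g \<Longrightarrow> agree D g h \<Longrightarrow> agree D f h" by (simp add: agree_def)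

lemma agree_mult: "agree D f g \<Longrightarrow> agree D f' g' \<Longrightarrow> agree D (f * f') (g * g')"
  unfolding agree_def fps_mult_nth by (intro allI impI sum.cong) auto

lemma agree_mult_cancel:
  assumes "agree D (h * f) (h * g)" "fps_nth h 0 \<noteq> 0"
  shows "agree D f g"
proof -
  have "agree D (inverse h * (h * f)) (inverse h * (h * g))"
    by (rule agree_mult[OF agree_refl assms(1)])
  then show ?thesis by (simp add: inverse_mult_eq_1[OF assms(2)] flip: mult.assoc)
qed

lemma tendsto_fps_mult:
  fixes f g :: "nat \<Rightarrow> rat fps"
  assumes "f \<longlonglongrightarrow> F" "g \<longlonglongrightarrow> G"
  shows "(\<lambda>n. f n * g n) \<longlonglongrightarrow> F * G"
proof (rule tendsto_fpsI)
  fix d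
  have "\<forall>\<^sub>F n in sequentially. \<forall>k\<in>{..d}. fps_nth (f n) k = fps_nth F k"
       "\<forall>\<^sub>F n in sequentially. \<forall>k\<in>{..d}. fps_nth (g n) k = fps_nth G k"
    using assms by (auto simp: tendsto_fps_iff eventually_ball_finite_distrib)
  then show "\<forall>\<^sub>F n in sequentially. fps_nth (f n * g n) d = fps_nth (F * G) d"
    by eventually_elim (simp add: fps_mult_nth)
qed

lemma tendsto_fps_prod:
  fixes f :: "'i \<Rightarrow> nat \<Rightarrow> rat fps"
  assumes "\<And>r. r \<in> I \<Longrightarrow> f r \<longlonglongrightarrow> F r"
  shows "(\<lambda>n. \<Prod>r\<in>I. f r n) \<longlonglongrightarrow> (\<Prod>r\<in>I. F r)"
  using assms by (induction I rule: infinite_finite_induct) (auto intro: tendsto_fps_mult)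

text \<open>The product (s q^a; q^m)_inf. For m > 0 all factors with index above n are 1 +
  O(q^(n+1)), so the first n + 1 factors fix coefficient n, even when a = 0.\<close>

definition qprod :: "rat \<Rightarrow> nat \<Rightarrow> nat \<Rightarrow> rat fps" where
  "qprod s a m = Abs_fps (\<lambda>n. fps_nth (\<Prod>i<Suc n. 1 - fps_const s * fps_X ^ (a + m * i)) n)"

lemma qprod_nth:
  assumes "m > 0" "n < N"
  shows "fps_nth (\<Prod>i<N. 1 - fps_const s * fps_X ^ (a + m * i)) n = fps_nth (qprod s a m) n"
proof -
  have "Suc n \<le> N" using assms(2) by simp
  then have "fps_nth (\<Prod>i<N. 1 - fps_const s * fps_X ^ (a + m * i)) n =
      fps_nth (\<Prod>i<Suc n. 1 - fps_const s * fps_X ^ (a + m * i)) n"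
  proof (induction N rule: dec_induct)
    case (step N)
    have "n < N" using step by simp
    also have "N \<le> a + m * N" using assms(1) by (cases m) auto
    finally have "n < a + m * N" .
    then show ?case
      by (simp add: step.IH right_diff_distrib mult.left_commute[of _ "fps_const s"]
          fps_X_power_mult_right_nth del: prod.lessThan_Suc add: prod.lessThan_Suc[of _ N])
  qed simp
  then show ?thesis by (simp add: qprod_def)
qed

lemma qprod_tendsto:
  assumes "m > 0"
  shows "(\<lambda>N. \<Prod>i<N. 1 - fps_const s * fps_X ^ (a + m * i)) \<longlonglongrightarrow> qprod s a m"
proof (rule tendsto_fpsI)
  fix n
  show "\<forall>\<^sub>F N in sequentially. fps_nth (\<Prod>i<N. 1 - fps_const s * fps_X ^ (a + m * i)) n = fps_nth (qprod s a m) n"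
    using eventually_gt_at_top[of n] by eventually_elim (rule qprod_nth[OF assms])
qed

lemma euler_f_eq_qprod: "k > 0 \<Longrightarrow> euler_f k = qprod 1 k k"
  by (rule fps_ext) (simp add: euler_f_nth qprod_def lessThan_Suc_atMost del: prod.lessThan_Suc)

lemma qprod_dissect:
  assumes "m > 0" "c > 0"
  shows "qprod s a m = (\<Prod>r<c. qprod s (a + m * r) (m * c))"
proof (rule LIMSEQ_unique)
  have "filterlim (\<lambda>N. N * c) sequentially sequentially"
    using assms(2) by (simp add: filterlim_subseq strict_mono_def)
  then show "(\<lambda>N. \<Prod>i<N * c. 1 - fps_const s * fps_X ^ (a + m * i)) \<longlonglongrightarrow> qprod s a m"
    by (rule filterlim_compose[OF qprod_tendsto[OF assms(1)]])
  have "(\<Prod>i<N * c. 1 - fps_const s * fps_X ^ (a + m * i)) =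
      (\<Prod>r<c. \<Prod>i<N. 1 - fps_const s * fps_X ^ (a + m * r + m * c * i))" for N
  proof -
    have "(\<Prod>i<N * c. 1 - fps_const s * fps_X ^ (a + m * i)) =
      (\<Prod>i<N. \<Prod>j = i * c..<i * c + c. 1 - fps_const s * fps_X ^ (a + m * j))"
      by (rule prod.nat_group[symmetric])
    also have "\<dots> = (\<Prod>i<N. \<Prod>r<c. 1 - fps_const s * fps_X ^ (a + m * r + m * c * i))"
    proof (rule prod.cong[OF refl])
      fix i
      show "(\<Prod>j = i * c..<i * c + c. 1 - fps_const s * fps_X ^ (a + m * j)) =
        (\<Prod>r<c. 1 - fps_const s * fps_X ^ (a + m * r + m * c * i))"
        using prod.shift_bounds_nat_ivl[of "\<lambda>j. 1 - fps_const s * fps_X ^ (a + m * j)" 0 "i * c" c]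
        by (simp add: atLeast0LessThan algebra_simps)
    qed
    also have "\<dots> = (\<Prod>r<c. \<Prod>i<N. 1 - fps_const s * fps_X ^ (a + m * r + m * c * i))"
      by (rule prod.swap)
    finally show ?thesis .
  qed
  moreover have "(\<lambda>N. \<Prod>r<c. \<Prod>i<N. 1 - fps_const s * fps_X ^ (a + m * r + m * c * i))
      \<longlonglongrightarrow> (\<Prod>r<c. qprod s (a + m * r) (m * c))"
    using assms by (intro tendsto_fps_prod qprod_tendsto) simp
  ultimately show "(\<lambda>N. \<Prod>i<N * c. 1 - fps_const s * fps_X ^ (a + m * i)) \<longlonglongrightarrow>
      (\<Prod>r<c. qprod s (a + m * r) (m * c))"
    by simp
qed

lemma qprod_mult_neg:
  assumes "m > 0"
  shows "qprod 1 a m * qprod (- 1) a m = qprod 1 (2 * a) (2 * m)"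
proof (rule LIMSEQ_unique)
  show "(\<lambda>N. (\<Prod>i<N. 1 - fps_const 1 * fps_X ^ (a + m * i)) *
      (\<Prod>i<N. 1 - fps_const (- 1) * fps_X ^ (a + m * i))) \<longlonglongrightarrow> qprod 1 a m * qprod (- 1) a m"
    by (intro tendsto_fps_mult qprod_tendsto assms)
  have "1 - fps_const 1 * fps_X ^ (2 * a + 2 * m * i) =
    (1 - fps_const 1 * fps_X ^ (a + m * i)) * (1 - fps_const (- 1) * fps_X ^ (a + m * i) :: rat fps)" for i
  proof -
    have "(fps_X :: rat fps) ^ (2 * a + 2 * m * i) = fps_X ^ (a + m * i) * fps_X ^ (a + m * i)"
      by (simp flip: power_add add: algebra_simps mult_2)
    then show ?thesis by (simp add: algebra_simps fps_const_neg[symmetric] del: fps_const_neg)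
  qed
  then have eq: "(\<Prod>i<N. 1 - fps_const 1 * fps_X ^ (a + m * i)) *
      (\<Prod>i<N. 1 - fps_const (- 1) * fps_X ^ (a + m * i)) =
      (\<Prod>i<N. 1 - fps_const 1 * fps_X ^ (2 * a + 2 * m * i) :: rat fps)" for N
    by (simp only: prod.distrib[symmetric])
  show "(\<lambda>N. (\<Prod>i<N. 1 - fps_const 1 * fps_X ^ (a + m * i)) *
      (\<Prod>i<N. 1 - fps_const (- 1) * fps_X ^ (a + m * i))) \<longlonglongrightarrow> qprod 1 (2 * a) (2 * m)"
    unfolding eq using assms by (intro qprod_tendsto) simp
qed

text \<open>Wanted at a = 0, where (-1; q)_inf splits off its factor 2.\<close>

lemma qprod_first_factor:
  assumes "m > 0"
  shows "qprod s a m = (1 - fps_const s * fps_X ^ a) * qprod s (a + m) m"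
proof (rule LIMSEQ_unique)
  show "(\<lambda>N. \<Prod>i<Suc N. 1 - fps_const s * fps_X ^ (a + m * i)) \<longlonglongrightarrow> qprod s a m"
    by (rule LIMSEQ_Suc[OF qprod_tendsto[OF assms]])
  have "(\<Prod>i<Suc N. 1 - fps_const s * fps_X ^ (a + m * i)) =
    (1 - fps_const s * fps_X ^ a) * (\<Prod>i<N. 1 - fps_const s * fps_X ^ (a + m + m * i))" for N
    by (simp add: prod.lessThan_Suc_shift add.assoc del: prod.lessThan_Suc)
  then show "(\<lambda>N. \<Prod>i<Suc N. 1 - fps_const s * fps_X ^ (a + m * i)) \<longlonglongrightarrow>
      (1 - fps_const s * fps_X ^ a) * qprod s (a + m) m"
    using tendsto_fps_mult[OF tendsto_const qprod_tendsto[OF assms]] by simp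
qed

section \<open>The Jacobi triple product\<close>

fun gauss_binomial :: "'a::comm_ring_1 \<Rightarrow> nat \<Rightarrow> nat \<Rightarrow> 'a" where
  "gauss_binomial Q n 0 = 1"
| "gauss_binomial Q 0 (Suc k) = 0"
| "gauss_binomial Q (Suc n) (Suc k) = gauss_binomial Q n k + Q ^ Suc k * gauss_binomial Q n (Suc k)"

lemma gauss_binomial_eq_0: "n < k \<Longrightarrow> gauss_binomial Q n k = 0"
  by (induction Q n k rule: gauss_binomial.induct) auto

lemma gauss_binomial_self: "gauss_binomial Q n n = 1"
  by (induction n) (auto simp: gauss_binomial_eq_0)

text \<open>The second q-Pascal rule. In the finite triple product it absorbs a new factor in
  \<open>x\<close>, while the defining rule absorbs a new factor in \<open>y\<close>.\<close>

lemma gauss_binomial_Suc_Suc':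
  "k \<le> n \<Longrightarrow> gauss_binomial Q (Suc n) (Suc k) = gauss_binomial Q n (Suc k) + Q ^ (n - k) * gauss_binomial Q n k"
proof (induction n arbitrary: k)
  case (Suc n)
  show ?case
  proof (cases k)
    case 0
    then show ?thesis using Suc.IH[of 0] by (simp add: algebra_simps)
  next
    case (Suc i)
    show ?thesis
    proof (cases "i = n")
      case True
      then show ?thesis using Suc by (simp add: gauss_binomial_eq_0 gauss_binomial_self)
    next
      case False
      with Suc \<open>k \<le> Suc n\<close> have i: "i < n" by simp
      have "gauss_binomial Q (Suc (Suc n)) (Suc k) =
        gauss_binomial Q (Suc n) (Suc i) + Q ^ (i + 2) * gauss_binomial Q (Suc n) (Suc (Suc i))"
        by (simp add: Suc)
      also have "\<dots> = gauss_binomial Q n (Suc i) + Q ^ (n - i) * gauss_binomial Q n i +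
          Q ^ (i + 2) * (gauss_binomial Q n (Suc (Suc i)) + Q ^ (n - Suc i) * gauss_binomial Q n (Suc i))"
        using i by (simp only: Suc.IH less_imp_le Suc_leI)
      also have "\<dots> = gauss_binomial Q n (Suc i) + Q ^ (i + 2) * gauss_binomial Q n (Suc (Suc i)) +
          Q ^ (n - i) * (gauss_binomial Q n i + Q ^ Suc i * gauss_binomial Q n (Suc i))"
      proof -
        have "Q ^ (i + 2) * Q ^ (n - Suc i) = Q ^ (n - i) * Q ^ Suc i"
          unfolding power_add[symmetric] using i by simp
        then show ?thesis by (simp add: distrib_left mult.assoc[symmetric] del: power_Suc)
      qed
      also have "\<dots> = gauss_binomial Q (Suc n) (Suc k) + Q ^ (Suc n - k) * gauss_binomial Q (Suc n) k"
        by (simp add: Suc)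
      finally show ?thesis .
    qed
  qed
qed simp

lemma gauss_binomial_factorial:
  fixes Q :: "'a::comm_ring_1"
  defines "p \<equiv> \<lambda>N. \<Prod>i<N. 1 - Q ^ Suc i"
  shows "p i * p j * gauss_binomial Q (i + j) j = p (i + j)"
proof (induction "i + j" arbitrary: i j)
  case 0
  then show ?case by (simp add: p_def)
next
  case (Suc n)
  show ?case
  proof (cases "i = 0 \<or> j = 0")
    case True
    then show ?thesis by (auto simp: p_def gauss_binomial_self)
  next
    case False
    then obtain i' j' where ij: "i = Suc i'" "j = Suc j'" by (metis not0_implies_Suc)
    have p: "p (Suc k) = p k * (1 - Q ^ Suc k)" for k by (simp add: p_def)
    have IH1: "p i * p j' * gauss_binomial Q (Suc (i' + j')) j' = p (Suc (i' + j'))"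
      using Suc.hyps(1)[of i j'] Suc.hyps(2) by (simp add: ij)
    have IH2: "p i' * p j * gauss_binomial Q (Suc (i' + j')) j = p (Suc (i' + j'))"
      using Suc.hyps(1)[of i' j] Suc.hyps(2) by (simp add: ij)
    have "p i * p j * gauss_binomial Q (i + j) j =
      (1 - Q ^ Suc j') * (p i * p j' * gauss_binomial Q (Suc (i' + j')) j')
      + Q ^ Suc j' * (1 - Q ^ Suc i') * (p i' * p j * gauss_binomial Q (Suc (i' + j')) j)"
      by (simp add: ij p algebra_simps)
    also have "\<dots> = p (Suc (i' + j')) * (1 - Q ^ Suc (Suc (i' + j')))"
      unfolding IH1 IH2 by (simp add: algebra_simps power_add)
    finally show ?thesis by (simp add: ij p)
  qed
qed

text \<open>The hypotheses on \<open>t\<close> say that \<open>t k = x^(k (k + 1) / 2) y^(k (k - 1) / 2)\<close> with \<open>Q = x y\<close>,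
  without dividing by \<open>x\<close> or \<open>y\<close>.\<close>

lemma finite_triple_product:
  fixes Q x y :: "'a::comm_ring_1"
  assumes "t 0 = 1"
    and tx: "\<And>k m. k \<le> int m \<Longrightarrow> t k * (x * Q ^ m) = t (k + 1) * Q ^ nat (int m - k)"
    and ty: "\<And>k n. - k \<le> int n \<Longrightarrow> t k * (y * Q ^ n) = t (k - 1) * Q ^ nat (int n + k)"
  shows "(\<Prod>i<m. 1 + x * Q ^ i) * (\<Prod>i<n. 1 + y * Q ^ i) =
    (\<Sum>j\<le>m + n. gauss_binomial Q (m + n) j * t (int j - int n))"
proof (induction n)
  case 0
  show ?case
  proof (induction m)
    case 0
    then show ?case by (simp add: assms)
  next
    case (Suc m)
    have "(\<Prod>i<Suc m. 1 + x * Q ^ i) =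
        (\<Sum>j\<le>m. gauss_binomial Q m j * t (int j)) + (\<Sum>j\<le>m. gauss_binomial Q m j * t (int j)) * (x * Q ^ m)"
      using Suc.IH by (simp add: algebra_simps)
    also have "(\<Sum>j\<le>m. gauss_binomial Q m j * t (int j)) * (x * Q ^ m) =
        (\<Sum>j\<le>m. Q ^ (m - j) * gauss_binomial Q m j * t (int (Suc j)))"
      unfolding sum_distrib_right
    proof (intro sum.cong refl)
      fix j assume "j \<in> {..m}"
      then show "gauss_binomial Q m j * t (int j) * (x * Q ^ m) =
          Q ^ (m - j) * gauss_binomial Q m j * t (int (Suc j))"
        using tx[of "int j" m] by (simp add: mult.assoc nat_diff_distrib) (simp add: ac_simps)
    qed
    \<comment> \<open>The added term vanishes; it lets j = 0 be split off and the rest be shifted to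
      the form of the q-Pascal rule.\<close>
    also have "(\<Sum>j\<le>m. gauss_binomial Q m j * t (int j)) = (\<Sum>j\<le>Suc m. gauss_binomial Q m j * t (int j))"
      by (simp add: gauss_binomial_eq_0)
    also have "\<dots> = t 0 + (\<Sum>j\<le>m. gauss_binomial Q m (Suc j) * t (int (Suc j)))"
      by (subst sum.atMost_Suc_shift) simp
    also have "t 0 + (\<Sum>j\<le>m. gauss_binomial Q m (Suc j) * t (int (Suc j))) +
        (\<Sum>j\<le>m. Q ^ (m - j) * gauss_binomial Q m j * t (int (Suc j))) =
        t 0 + (\<Sum>j\<le>m. gauss_binomial Q (Suc m) (Suc j) * t (int (Suc j)))"
      unfolding add.assoc sum.distrib[symmetric]
      by (intro arg_cong2[of _ _ _ _ "(+)"] refl sum.cong)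
        (simp add: gauss_binomial_Suc_Suc' distrib_right del: gauss_binomial.simps)
    also have "\<dots> = (\<Sum>j\<le>Suc m. gauss_binomial Q (Suc m) j * t (int j))"
      by (subst sum.atMost_Suc_shift) simp
    finally show ?case by simp
  qed
next
  case (Suc n)
  let ?N = "m + n"
  have "(\<Prod>i<m. 1 + x * Q ^ i) * (\<Prod>i<Suc n. 1 + y * Q ^ i) =
      (\<Sum>j\<le>?N. gauss_binomial Q ?N j * t (int j - int n))
      + (\<Sum>j\<le>?N. gauss_binomial Q ?N j * t (int j - int n)) * (y * Q ^ n)"
    unfolding Suc.IH[symmetric] by (simp add: algebra_simps)
  also have "(\<Sum>j\<le>?N. gauss_binomial Q ?N j * t (int j - int n)) * (y * Q ^ n) =
      (\<Sum>j\<le>?N. Q ^ j * gauss_binomial Q ?N j * t (int j - int (Suc n)))"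
    unfolding sum_distrib_right
  proof (intro sum.cong refl)
    fix j
    have "t (int j - int n) * (y * Q ^ n) = Q ^ j * t (int j - int (Suc n))"
      using ty[of "int j - int n" n] by (simp add: algebra_simps)
    then have "gauss_binomial Q ?N j * (t (int j - int n) * (y * Q ^ n)) =
        gauss_binomial Q ?N j * (Q ^ j * t (int j - int (Suc n)))"
      by (simp only:)
    then show "gauss_binomial Q ?N j * t (int j - int n) * (y * Q ^ n) =
        Q ^ j * gauss_binomial Q ?N j * t (int j - int (Suc n))"
      by (simp only: ac_simps)
  qed
  also have "\<dots> = (\<Sum>j\<le>Suc ?N. Q ^ j * gauss_binomial Q ?N j * t (int j - int (Suc n)))"
    by (simp add: gauss_binomial_eq_0)
  also have "\<dots> = t (- int (Suc n)) +
      (\<Sum>j\<le>?N. Q ^ Suc j * gauss_binomial Q ?N (Suc j) * t (int (Suc j) - int (Suc n)))"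
    by (subst sum.atMost_Suc_shift) simp
  also have "(\<Sum>j\<le>?N. gauss_binomial Q ?N j * t (int j - int n)) + \<dots> =
      t (- int (Suc n)) + (\<Sum>j\<le>?N. gauss_binomial Q (Suc ?N) (Suc j) * t (int (Suc j) - int (Suc n)))"
    by (simp add: sum.distrib algebra_simps)
  also have "\<dots> = (\<Sum>j\<le>Suc ?N. gauss_binomial Q (Suc ?N) j * t (int j - int (Suc n)))"
    by (subst sum.atMost_Suc_shift) simp
  finally show ?case by simp
qed

lemma euler_f_agree:
  assumes "k > 0" "D \<le> N"
  shows "agree D (\<Prod>i<N. 1 - (fps_X ^ k) ^ Suc i) (euler_f k)"
proof -
  have "(fps_X ^ k) ^ Suc i = (fps_const 1 * fps_X ^ (k + k * i) :: rat fps)" for i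
    by (simp flip: power_mult add: power_add)
  then have eq: "(\<Prod>i<N. 1 - (fps_X ^ k) ^ Suc i) = (\<Prod>i<N. 1 - fps_const 1 * fps_X ^ (k + k * i) :: rat fps)"
    by (simp only:)
  show ?thesis
    unfolding agree_def euler_f_eq_qprod[OF assms(1)] eq
  proof (intro allI impI)
    fix n assume "n < D"
    then show "fps_nth (\<Prod>i<N. 1 - fps_const 1 * fps_X ^ (k + k * i)) n = fps_nth (qprod 1 k k) n"
      using assms by (intro qprod_nth) auto
  qed
qed

text \<open>Modulo q^D all three q-factorials of the binomial equal \<open>euler_f k\<close>, so the
  binomial is congruent to 1 / \<open>euler_f k\<close>.\<close>

lemma gauss_binomial_agree:
  assumes "k > 0" "D \<le> i" "D \<le> j"
  shows "agree D (euler_f k * gauss_binomial (fps_X ^ k) (i + j) j) 1"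
proof -
  define p where "p N = (\<Prod>i<N. 1 - (fps_X ^ k :: rat fps) ^ Suc i)" for N
  have p: "agree D (p N) (euler_f k)" if "D \<le> N" for N
    unfolding p_def using assms(1) that by (rule euler_f_agree)
  let ?G = "gauss_binomial (fps_X ^ k) (i + j) j :: rat fps"
  have "agree D (euler_f k * euler_f k * ?G) (p i * p j * ?G)"
    by (intro agree_mult agree_refl agree_sym[OF p] assms)
  also have "p i * p j * ?G = p (i + j)"
    unfolding p_def by (rule gauss_binomial_factorial)
  also have "agree D \<dots> (euler_f k)" using assms by (intro p) simp
  finally have "agree D (euler_f k * (euler_f k * ?G)) (euler_f k * 1)" by (simp add: mult.assoc)
  then show ?thesis by (rule agree_mult_cancel) (simp add: euler_f_nth_0 assms)
qed

text \<open>Let the finite identity with n factors of each kind tend to its limit: multiplied by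
  \<open>euler_f (a + b)\<close>, the Gaussian binomials near the centre become 1 to any fixed
  order.\<close>

theorem jacobi_triple_product:
  assumes s: "s = 1 \<or> s = - 1" and ab: "a + b > 0"
  shows "theta s a b = qprod (- s) a (a + b) * qprod (- s) b (a + b) * euler_f (a + b)"
proof -
  define Q :: "rat fps" where "Q = fps_X ^ (a + b)"
  define x y :: "rat fps" where "x = fps_const s * fps_X ^ a" and "y = fps_const s * fps_X ^ b"
  define E :: "int \<Rightarrow> nat" where "E k = nat \<lfloor>theta_exp a b k\<rfloor>" for k
  define t :: "int \<Rightarrow> rat fps" where "t k = fps_const (parity_sign s k) * fps_X ^ E k" for k
  have E: "of_nat (E k) = theta_exp a b k" for k
    using theta_exp_Nats[of a b k] by (auto simp: E_def elim!: Nats_cases)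
  have Eq: "E k + i = E l + j" if "theta_exp a b k + of_nat i = theta_exp a b l + of_nat j" for k l i j
    using that unfolding E[symmetric] by (simp flip: of_nat_add)
  have "t 0 = 1"
  proof -
    have "E 0 = 0" using E[of 0] by (simp add: theta_exp_def)
    then show ?thesis by (simp add: t_def parity_sign_def)
  qed
  have sgn: "parity_sign s k * s = parity_sign s (k + 1)" "parity_sign s k * s = parity_sign s (k - 1)" for k
    using s by (auto simp: parity_sign_def)
  have tx: "t k * (x * Q ^ m) = t (k + 1) * Q ^ nat (int m - k)" if "k \<le> int m" for k m
  proof -
    have "E k + (a + (a + b) * m) = E (k + 1) + (a + b) * nat (int m - k)"
      by (rule Eq) (use that in \<open>simp add: theta_exp_def field_simps\<close>)
    then have "(fps_X :: rat fps) ^ E k * (fps_X ^ a * Q ^ m) = fps_X ^ E (k + 1) * Q ^ nat (int m - k)"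
      unfolding Q_def power_mult[symmetric] power_add[symmetric] by (simp only:)
    then show ?thesis
      unfolding t_def x_def sgn(1)[symmetric] fps_const_mult[symmetric] by (simp only: ac_simps)
  qed
  have ty: "t k * (y * Q ^ n) = t (k - 1) * Q ^ nat (int n + k)" if "- k \<le> int n" for k n
  proof -
    have "E k + (b + (a + b) * n) = E (k - 1) + (a + b) * nat (int n + k)"
      by (rule Eq) (use that in \<open>simp add: theta_exp_def field_simps\<close>)
    then have "(fps_X :: rat fps) ^ E k * (fps_X ^ b * Q ^ n) = fps_X ^ E (k - 1) * Q ^ nat (int n + k)"
      unfolding Q_def power_mult[symmetric] power_add[symmetric] by (simp only:)
    then show ?thesis
      unfolding t_def y_def sgn(2)[symmetric] fps_const_mult[symmetric] by (simp only: ac_simps)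
  qed
  define F where "F n = (\<Prod>i<n. 1 + x * Q ^ i) * (\<Prod>i<n. 1 + y * Q ^ i) * euler_f (a + b)" for n
  have "F \<longlonglongrightarrow> qprod (- s) a (a + b) * qprod (- s) b (a + b) * euler_f (a + b)"
  proof -
    have "1 + x * Q ^ i = 1 - fps_const (- s) * fps_X ^ (a + (a + b) * i)"
         "1 + y * Q ^ i = 1 - fps_const (- s) * fps_X ^ (b + (a + b) * i)" for i
      by (simp_all add: x_def y_def Q_def power_add power_mult mult.assoc fps_const_neg[symmetric] del: fps_const_neg)
    then show ?thesis unfolding F_def
      by (simp only:) (intro tendsto_fps_mult qprod_tendsto ab tendsto_const)
  qed
  moreover have "F \<longlonglongrightarrow> theta s a b"
  proof (rule tendsto_fpsI)
    fix d
    show "\<forall>\<^sub>F n in sequentially. fps_nth (F n) d = fps_nth (theta s a b) d"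
      \<comment> \<open>Only |k| <= d + 1 can contribute to q^d. For such k both \<open>j\<close>
        and \<open>n + n - j\<close> are at least n - (d + 1) >= d + 1, the precision required of
        the binomial.\<close>
      using eventually_ge_at_top[of "2 * d + 2"]
    proof eventually_elim
      case (elim n)
      have "F n = (\<Sum>j\<le>n + n. euler_f (a + b) * gauss_binomial Q (n + n) j * t (int j - int n))"
      proof -
        have "(\<Prod>i<n. 1 + x * Q ^ i) * (\<Prod>i<n. 1 + y * Q ^ i) =
            (\<Sum>j\<le>n + n. gauss_binomial Q (n + n) j * t (int j - int n))"
          using \<open>t 0 = 1\<close> tx ty by (rule finite_triple_product)
        then show ?thesis unfolding F_def by (simp add: sum_distrib_left mult.commute mult.left_commute)
      qed
      also have "fps_nth \<dots> d = (\<Sum>j\<le>n + n. if E (int j - int n) = d then parity_sign s (int j - int n) else 0)"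
        unfolding fps_sum_nth
      proof (rule sum.cong[OF refl])
        fix j assume j: "j \<in> {..n + n}"
        let ?k = "int j - int n" and ?G = "euler_f (a + b) * gauss_binomial Q (n + n) j"
        have eq: "fps_nth (?G * t ?k) d = (if d < E ?k then 0 else parity_sign s ?k * fps_nth ?G (d - E ?k))"
          unfolding t_def mult.left_commute[of ?G] by (simp add: fps_X_power_mult_right_nth)
        show "fps_nth (?G * t ?k) d = (if E ?k = d then parity_sign s ?k else 0)"
        proof (cases "d < E ?k")
          case False
          have "of_int (\<bar>?k\<bar> - 1) \<le> (of_nat (E ?k) :: rat)"
            using theta_exp_ge[OF ab, of ?k] E by simp
          then have "of_int (\<bar>?k\<bar> - 1) \<le> (of_int (int (E ?k)) :: rat)" by simp
          then have "\<bar>?k\<bar> \<le> int d + 1" using False unfolding of_int_le_iff by simp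
          then have "agree (Suc d) (euler_f (a + b) * gauss_binomial Q ((n + n - j) + j) j) 1"
            unfolding Q_def using ab elim j by (intro gauss_binomial_agree) auto
          then have "fps_nth ?G (d - E ?k) = fps_nth 1 (d - E ?k)"
            using j unfolding agree_def by simp
          then show ?thesis using False eq by auto
        qed (use eq in auto)
      qed
      also have "\<dots> = (\<Sum>j | j \<le> n + n \<and> E (int j - int n) = d. parity_sign s (int j - int n))"
        by (simp add: sum.If_cases Collect_conj_eq atMost_def)
      also have "\<dots> = (\<Sum>k | E k = d. parity_sign s k)"
      proof (rule sum.reindex_bij_witness[of _ "\<lambda>k. nat (k + int n)" "\<lambda>j. int j - int n"], goal_cases)
        case (4 k)
        then have "\<bar>k\<bar> \<le> int d + 1" using theta_exp_bounded[OF ab, of k d] E[of k] by simp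
        then show ?case using 4 elim by auto
      next
        case (3 k)
        then have "\<bar>k\<bar> \<le> int d + 1" using theta_exp_bounded[OF ab, of k d] E[of k] by simp
        then show ?case using elim by auto
      qed auto
      also have "\<dots> = fps_nth (theta s a b) d"
        unfolding theta_def gen_series_nth E[symmetric] by simp
      finally show ?case .
    qed
  qed
  ultimately show ?thesis by (rule LIMSEQ_unique[rotated])
qed

section \<open>Product relations\<close>

lemma prod_lessThan_2_3_5:
  fixes g :: "nat \<Rightarrow> 'a::comm_monoid_mult"
  shows "(\<Prod>r<2. g r) = g 0 * g 1"
    and "(\<Prod>r<3. g r) = g 0 * g 1 * g 2"
    and "(\<Prod>r<5. g r) = g 0 * g 1 * g 2 * g 3 * g 4"
  by (simp_all add: eval_nat_numeral lessThan_Suc ac_simps)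

text \<open>Euler's pentagonal number theorem: the factors of the product, sorted modulo 3, are
  those of a triple product.\<close>

lemma euler_f_eq_theta:
  assumes "k > 0"
  shows "euler_f k = theta (- 1) k (2 * k)"
  using assms qprod_dissect[of k 3 1 k]
  by (simp add: jacobi_triple_product euler_f_eq_qprod prod_lessThan_2_3_5 ac_simps flip: mult_2)

lemma euler_f_compose:
  assumes "c > 0" "k > 0"
  shows "euler_f k oo fps_X ^ c = euler_f (c * k)"
  using assms by (simp add: euler_f_eq_theta theta_compose mult.left_commute)

lemma theta_products:
  shows theta_1_4_mult_theta_2_3: "theta (- 1) 1 4 * theta (- 1) 2 3 = euler_f 1 * euler_f 5"
    and theta_2_8_mult_theta_4_6: "theta (- 1) 2 8 * theta (- 1) 4 6 = euler_f 2 * euler_f 10"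
    and theta_3_7_mult_theta_2_8:
      "theta (- 1) 3 7 * theta (- 1) 2 8 * euler_f 5 = euler_f 10 ^ 2 * theta (- 1) 2 3"
    and theta_1_9_mult_theta_4_6:
      "theta (- 1) 1 9 * theta (- 1) 4 6 * euler_f 5 = euler_f 10 ^ 2 * theta (- 1) 1 4"
  using qprod_dissect[of 1 5 1 1] qprod_dissect[of 2 5 1 2] qprod_dissect[of 5 2 1 1]
    qprod_dissect[of 5 2 1 2] qprod_dissect[of 5 2 1 3] qprod_dissect[of 5 2 1 4]
  by (simp_all add: jacobi_triple_product euler_f_eq_qprod prod_lessThan_2_3_5 power2_eq_square ac_simps
      numeral_2_eq_2[symmetric] del: One_nat_def)

lemma theta_sign_products:
  shows theta_2_3_pos_mult_neg: "theta 1 2 3 * theta (- 1) 2 3 * euler_f 10 = euler_f 5 ^ 2 * theta (- 1) 4 6"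
    and theta_1_4_pos_mult_neg: "theta 1 1 4 * theta (- 1) 1 4 * euler_f 10 = euler_f 5 ^ 2 * theta (- 1) 2 8"
proof -
  have "theta 1 2 3 * theta (- 1) 2 3 * euler_f 10 = euler_f 5 ^ 2 *
      ((qprod 1 2 5 * qprod (- 1) 2 5) * (qprod 1 3 5 * qprod (- 1) 3 5)) * euler_f 10"
    by (simp add: jacobi_triple_product power2_eq_square ac_simps)
  then show "theta 1 2 3 * theta (- 1) 2 3 * euler_f 10 = euler_f 5 ^ 2 * theta (- 1) 4 6"
    by (simp add: qprod_mult_neg jacobi_triple_product numeral_2_eq_2[symmetric] ac_simps)
  have "theta 1 1 4 * theta (- 1) 1 4 * euler_f 10 = euler_f 5 ^ 2 *
      ((qprod 1 1 5 * qprod (- 1) 1 5) * (qprod 1 4 5 * qprod (- 1) 4 5)) * euler_f 10"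
    by (simp add: jacobi_triple_product power2_eq_square ac_simps)
  then show "theta 1 1 4 * theta (- 1) 1 4 * euler_f 10 = euler_f 5 ^ 2 * theta (- 1) 2 8"
    by (simp add: qprod_mult_neg jacobi_triple_product numeral_2_eq_2[symmetric] ac_simps)
qed

text \<open>Summing over all integers meets every triangular number twice, so
  \<open>theta 1 1 0\<close> is 2 \<psi>(q).\<close>

lemma theta_1_0_mult_euler_f: "theta 1 1 0 * euler_f 1 = 2 * euler_f 2 ^ 2"
proof -
  have "qprod (- 1) 0 1 = 2 * qprod (- 1) 1 1"
    using qprod_first_factor[of 1 "- 1" 0] by (simp add: numeral_fps_const[symmetric])
  then have "theta 1 1 0 * euler_f 1 = 2 * (qprod 1 1 1 * qprod (- 1) 1 1) ^ 2"
    by (simp add: jacobi_triple_product euler_f_eq_qprod power2_eq_square ac_simps)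
  then show ?thesis by (simp add: qprod_mult_neg euler_f_eq_qprod)
qed

text \<open>Gauss's product for Ramanujan's \<phi>(-q), which is
  \<open>theta (- 1) 1 1\<close>.\<close>

lemma theta_1_1_mult_euler_f: "theta (- 1) 1 1 * euler_f 2 = euler_f 1 ^ 2"
  using qprod_dissect[of 1 2 1 1]
  by (simp add: jacobi_triple_product euler_f_eq_qprod prod_lessThan_2_3_5 power2_eq_square ac_simps
      numeral_2_eq_2[symmetric] del: One_nat_def)

section \<open>Dissections of theta series\<close>

lemma bij_betw_mod_5: "bij_betw (\<lambda>(r, j). 5 * j + r) ({0, 1, 2, 3, 4} \<times> UNIV) (UNIV :: int set)"
proof (rule bij_betw_byWitness[where f' = "\<lambda>n. (n mod 5, n div 5)"])
  have "n mod 5 \<in> {0, 1, 2, 3, 4}" for n :: int by auto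
  then show "(\<lambda>n. (n mod 5, n div 5)) ` UNIV \<subseteq> {0, 1, 2, 3, 4} \<times> (UNIV :: int set)"
    by (simp add: image_subset_iff)
qed auto

lemma theta_split_mod_5:
  assumes "a + b > 0"
  shows "theta s a b = (\<Sum>r\<in>{0, 1, 2, 3, 4}. gen_series (\<lambda>j. parity_sign s (5 * j + r)) (\<lambda>j. theta_exp a b (5 * j + r)))"
  unfolding theta_def
  by (rule gen_series_split[OF bij_betw_mod_5 _ theta_exp_finite_fibres[OF assms]]) simp

text \<open>Triangular numbers n (n + 1) / 2 have residues 0, 1, 3, 1, 0 modulo 5 for n = 0, ..., 4.
  The reflection n -> -1 - n exchanges equal residues, whence the factors 2.\<close>

lemma theta_1_0_dissection:
  "theta 1 1 0 = 2 * theta 1 10 15 + 2 * fps_X * theta 1 5 20 + fps_X ^ 3 * theta 1 25 0"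
proof -
  let ?G = "\<lambda>r. gen_series (\<lambda>j. parity_sign 1 (5 * j + r)) (\<lambda>j. theta_exp 1 0 (5 * j + r))"
  have "?G 0 = fps_const 1 * fps_X ^ 0 * theta 1 10 15"
    by (rule gen_series_eq_theta[where u = "- 1" and t = 0])
      (simp_all add: parity_sign_def theta_exp_def field_simps)
  moreover have "?G 1 = fps_const 1 * fps_X ^ 1 * theta 1 5 20"
    by (rule gen_series_eq_theta[where u = "- 1" and t = 0])
      (simp_all add: parity_sign_def theta_exp_def field_simps)
  moreover have "?G 2 = fps_const 1 * fps_X ^ 3 * theta 1 25 0"
    by (rule gen_series_eq_theta[where u = 1 and t = 0])
      (simp_all add: parity_sign_def theta_exp_def field_simps)
  moreover have "?G 3 = fps_const 1 * fps_X ^ 1 * theta 1 5 20"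
    by (rule gen_series_eq_theta[where u = 1 and t = 1])
      (simp_all add: parity_sign_def theta_exp_def field_simps)
  moreover have "?G 4 = fps_const 1 * fps_X ^ 0 * theta 1 10 15"
    by (rule gen_series_eq_theta[where u = 1 and t = 1])
      (simp_all add: parity_sign_def theta_exp_def field_simps)
  moreover have "theta 1 1 0 = (\<Sum>r\<in>{0, 1, 2, 3, 4}. ?G r)"
    by (rule theta_split_mod_5) simp
  ultimately show ?thesis by (simp add: algebra_simps)
qed

text \<open>The exponents (3 n^2 - n) / 2 avoid the residues 3 and 4 modulo 5: index classes 0 and 2
  give residue 0, class 1 gives 1, classes 3 and 4 give 2.\<close>

lemma theta_1_2_dissection:
  "theta (- 1) 1 2 = (theta (- 1) 35 40 + fps_X ^ 5 * theta (- 1) 10 65)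
    - fps_X * theta (- 1) 25 50 - fps_X ^ 2 * (theta (- 1) 20 55 - fps_X ^ 5 * theta (- 1) 5 70)"
proof -
  let ?G = "\<lambda>r. gen_series (\<lambda>j. parity_sign (- 1) (5 * j + r)) (\<lambda>j. theta_exp 1 2 (5 * j + r))"
  have "?G 0 = fps_const 1 * fps_X ^ 0 * theta (- 1) 35 40"
    by (rule gen_series_eq_theta[where u = 1 and t = 0])
      (simp_all add: parity_sign_def theta_exp_def field_simps)
  moreover have "?G 1 = fps_const (- 1) * fps_X ^ 1 * theta (- 1) 25 50"
    by (rule gen_series_eq_theta[where u = "- 1" and t = 0])
      (simp_all add: parity_sign_def theta_exp_def field_simps)
  moreover have "?G 2 = fps_const 1 * fps_X ^ 5 * theta (- 1) 10 65"
    by (rule gen_series_eq_theta[where u = "- 1" and t = 0])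
      (simp_all add: parity_sign_def theta_exp_def field_simps)
  moreover have "?G 3 = fps_const 1 * fps_X ^ 7 * theta (- 1) 5 70"
    by (rule gen_series_eq_theta[where u = 1 and t = 1])
      (simp_all add: parity_sign_def theta_exp_def field_simps)
  moreover have "?G 4 = fps_const (- 1) * fps_X ^ 2 * theta (- 1) 20 55"
    by (rule gen_series_eq_theta[where u = 1 and t = 1])
      (simp_all add: parity_sign_def theta_exp_def field_simps)
  moreover have "theta (- 1) 1 2 = (\<Sum>r\<in>{0, 1, 2, 3, 4}. ?G r)"
    by (rule theta_split_mod_5) simp
  ultimately have "theta (- 1) 1 2 = theta (- 1) 35 40 - fps_X * theta (- 1) 25 50
      + fps_X ^ 5 * theta (- 1) 10 65 + fps_X ^ 7 * theta (- 1) 5 70 - fps_X ^ 2 * theta (- 1) 20 55"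
    by (simp add: fps_const_neg[symmetric] del: fps_const_neg)
  then show ?thesis by (simp add: algebra_simps)
qed

section \<open>Products of two theta series\<close>

text \<open>Multiplication by a Gaussian integer of norm 2: for r = 0, m^2 + n^2 = 2 (j^2 + k^2).
  Two theta series with equal a + b therefore acquire no cross term.\<close>

lemma bij_betw_index_2:
  "bij_betw (\<lambda>(r, y). case y of (j, k) \<Rightarrow> (j + k + r, j - k)) ({0, 1} \<times> UNIV) (UNIV :: (int \<times> int) set)"
proof (rule bij_betw_byWitness[where
    f' = "\<lambda>(m :: int, n :: int). ((m + n) mod 2, ((m + n) div 2, (m + n) div 2 - n))"])
  have "n mod 2 \<in> {0, 1}" for n :: int by auto
  then show "(\<lambda>(m, n). ((m + n) mod 2, ((m + n) div 2, (m + n) div 2 - n))) ` UNIV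
      \<subseteq> {0, 1} \<times> (UNIV :: (int \<times> int) set)"
    by (simp add: image_subset_iff split_beta)
qed (auto; presburger)+

text \<open>For r = 0, m - n w = (l + k w) (1 + w) with w^2 = -2, so m^2 + 2 n^2 = 3 (l^2 + 2 k^2).
  This diagonalises pairs whose second a + b is twice the first. The coset is read off from m - 2 n
  = 3 l + r.\<close>

lemma bij_betw_index_3:
  "bij_betw (\<lambda>(r, y). case y of (k, l) \<Rightarrow> (l + r - 2 * k, - (k + l))) ({0, 1, 2} \<times> UNIV) (UNIV :: (int \<times> int) set)"
proof (rule bij_betw_byWitness[where
    f' = "\<lambda>(m :: int, n :: int). ((m - 2 * n) mod 3, (- n - (m - 2 * n) div 3, (m - 2 * n) div 3))"])
  have "n mod 3 \<in> {0, 1, 2}" for n :: int by auto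
  then show "(\<lambda>(m, n). ((m - 2 * n) mod 3, (- n - (m - 2 * n) div 3, (m - 2 * n) div 3))) ` UNIV
      \<subseteq> {0, 1, 2} \<times> (UNIV :: (int \<times> int) set)"
    by (simp add: image_subset_iff split_beta)
qed (auto; presburger)+

text \<open>The inverse comes from m + 2 n + t = 5 j + r. The offset \<open>t\<close> moves the
  coset representatives, so that they can be centred for each series.\<close>

lemma bij_betw_index_5:
  "bij_betw (\<lambda>(r, y). case y of (j, k) \<Rightarrow> (j + 2 * k + r - t, 2 * j - k)) ({0, 1, 2, 3, 4} \<times> UNIV)
    (UNIV :: (int \<times> int) set)"
proof (rule bij_betw_byWitness[where
    f' = "\<lambda>(m :: int, n :: int). ((m + 2 * n + t) mod 5, ((m + 2 * n + t) div 5, 2 * ((m + 2 * n + t) div 5) - n))"])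
  have "n mod 5 \<in> {0, 1, 2, 3, 4}" for n :: int by auto
  then show "(\<lambda>(m, n). ((m + 2 * n + t) mod 5, ((m + 2 * n + t) div 5, 2 * ((m + 2 * n + t) div 5) - n))) ` UNIV
      \<subseteq> {0, 1, 2, 3, 4} \<times> (UNIV :: (int \<times> int) set)"
    by (simp add: image_subset_iff split_beta)
qed (auto; presburger)+

lemma theta_1_4_mult_theta_2_3_neg:
  "theta 1 1 4 * theta (- 1) 2 3 =
    theta (- 1) 3 7 * theta (- 1) 4 6 + fps_X * (theta (- 1) 2 8 * theta (- 1) 1 9)"
proof -
  let ?G = "\<lambda>r. gen_series (\<lambda>y. case case y of (j, k) \<Rightarrow> (j + k + r, j - k) of (m, n) \<Rightarrow> parity_sign 1 m * parity_sign (- 1) n)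
    (\<lambda>y. case case y of (j, k) \<Rightarrow> (j + k + r, j - k) of (m, n) \<Rightarrow> theta_exp 1 4 m + theta_exp 2 3 n)"
  have "?G 0 = fps_const 1 * fps_X ^ 0 * (theta (- 1) 3 7 * theta (- 1) 4 6)"
    by (rule gen_series_eq_theta_mult[where u = 1 and t = 0 and u' = 1 and t' = 0])
      (simp_all add: parity_sign_def theta_exp_def field_simps)
  moreover have "?G 1 = fps_const 1 * fps_X ^ 1 * (theta (- 1) 2 8 * theta (- 1) 1 9)"
    by (rule gen_series_eq_theta_mult[where u = "- 1" and t = 0 and u' = "- 1" and t' = 0])
      (simp_all add: parity_sign_def theta_exp_def field_simps)
  moreover have "theta 1 1 4 * theta (- 1) 2 3 = (\<Sum>r\<in>{0, 1}. ?G r)"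
    by (rule theta_mult_split[OF _ _ _ bij_betw_index_2]) simp_all
  ultimately show ?thesis
    by (simp add: algebra_simps fps_const_neg[symmetric] del: fps_const_neg)
qed

lemma theta_2_3_mult_theta_1_4_neg:
  "theta 1 2 3 * theta (- 1) 1 4 =
    theta (- 1) 3 7 * theta (- 1) 4 6 - fps_X * (theta (- 1) 2 8 * theta (- 1) 1 9)"
proof -
  let ?G = "\<lambda>r. gen_series (\<lambda>y. case case y of (j, k) \<Rightarrow> (j + k + r, j - k) of (m, n) \<Rightarrow> parity_sign 1 m * parity_sign (- 1) n)
    (\<lambda>y. case case y of (j, k) \<Rightarrow> (j + k + r, j - k) of (m, n) \<Rightarrow> theta_exp 2 3 m + theta_exp 1 4 n)"
  have "?G 0 = fps_const 1 * fps_X ^ 0 * (theta (- 1) 3 7 * theta (- 1) 4 6)"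
    by (rule gen_series_eq_theta_mult[where u = 1 and t = 0 and u' = "- 1" and t' = 0])
      (simp_all add: parity_sign_def theta_exp_def field_simps)
  moreover have "?G 1 = fps_const (- 1) * fps_X ^ 1 * (theta (- 1) 2 8 * theta (- 1) 1 9)"
    by (rule gen_series_eq_theta_mult[where u = "- 1" and t = 0 and u' = 1 and t' = 1])
      (simp_all add: parity_sign_def theta_exp_def field_simps)
  moreover have "theta 1 2 3 * theta (- 1) 1 4 = (\<Sum>r\<in>{0, 1}. ?G r)"
    by (rule theta_mult_split[OF _ _ _ bij_betw_index_2]) simp_all
  ultimately show ?thesis
    by (simp add: algebra_simps fps_const_neg[symmetric] del: fps_const_neg)
qed

text \<open>The next two identities are specialisations of the quintuple product identity: with indices \<open>m\<close>, \<open>n\<close> and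
  \<open>N = m + 2 n\<close>, the terms with \<open>N\<close> in one residue class modulo 3 cancel, while each of the other two classes
  splits off the factor \<open>euler_f 10\<close>.\<close>

lemma theta_1_4_mult_theta_3_7:
  "theta 1 1 4 * theta (- 1) 3 7 =
    theta (- 1) 10 20 * (theta (- 1) 7 8 + fps_X * theta (- 1) 2 13)"
proof -
  let ?G = "\<lambda>r. gen_series (\<lambda>y. case case y of (k, l) \<Rightarrow> (l + r - 2 * k, - (k + l)) of (m, n) \<Rightarrow> parity_sign 1 m * parity_sign (- 1) n)
    (\<lambda>y. case case y of (k, l) \<Rightarrow> (l + r - 2 * k, - (k + l)) of (m, n) \<Rightarrow> theta_exp 1 4 m + theta_exp 3 7 n)"
  have "?G 0 = fps_const 1 * fps_X ^ 0 * (theta (- 1) 10 20 * theta (- 1) 7 8)"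
    by (rule gen_series_eq_theta_mult[where u = "- 1" and t = 0 and u' = "- 1" and t' = 0])
      (simp_all add: parity_sign_def theta_exp_def field_simps)
  moreover have "?G 1 = fps_const 1 * fps_X ^ 1 * (theta (- 1) 10 20 * theta (- 1) 2 13)"
    by (rule gen_series_eq_theta_mult[where u = 1 and t = 0 and u' = "- 1" and t' = 0])
      (simp_all add: parity_sign_def theta_exp_def field_simps)
  moreover have "?G 2 = 0"
  proof (rule gen_series_antisymmetric)
    \<comment> \<open>The reflection k -> 1 - k preserves the exponent in class 2 and changes the
      parity of k + l, hence the sign.\<close>
    show "bij (\<lambda>(k :: int, l :: int). (1 - k, l))"
      by (rule o_bij[where g = "\<lambda>(k, l). (1 - k, l)"]) (auto simp: fun_eq_iff)
  qed (auto simp: parity_sign_def theta_exp_def field_simps)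
  moreover have "theta 1 1 4 * theta (- 1) 3 7 = (\<Sum>r\<in>{0, 1, 2}. ?G r)"
    by (rule theta_mult_split[OF _ _ _ bij_betw_index_3]) simp_all
  ultimately show ?thesis
    by (simp add: algebra_simps fps_const_neg[symmetric] del: fps_const_neg)
qed

lemma theta_2_3_mult_theta_1_9:
  "theta 1 2 3 * theta (- 1) 1 9 =
    theta (- 1) 10 20 * (theta (- 1) 4 11 - fps_X * theta (- 1) 1 14)"
proof -
  let ?G = "\<lambda>r. gen_series (\<lambda>y. case case y of (k, l) \<Rightarrow> (l + r - 2 * k, - (k + l)) of (m, n) \<Rightarrow> parity_sign 1 m * parity_sign (- 1) n)
    (\<lambda>y. case case y of (k, l) \<Rightarrow> (l + r - 2 * k, - (k + l)) of (m, n) \<Rightarrow> theta_exp 2 3 m + theta_exp 1 9 n)"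
  have "?G 0 = fps_const 1 * fps_X ^ 0 * (theta (- 1) 10 20 * theta (- 1) 4 11)"
    by (rule gen_series_eq_theta_mult[where u = "- 1" and t = 0 and u' = "- 1" and t' = 0])
      (simp_all add: parity_sign_def theta_exp_def field_simps)
  moreover have "?G 1 = fps_const (- 1) * fps_X ^ 1 * (theta (- 1) 10 20 * theta (- 1) 1 14)"
    by (rule gen_series_eq_theta_mult[where u = 1 and t = 0 and u' = 1 and t' = 1])
      (simp_all add: parity_sign_def theta_exp_def field_simps)
  moreover have "?G 2 = 0"
  proof (rule gen_series_antisymmetric)
    show "bij (\<lambda>(k :: int, l :: int). (1 - k, l))"
      by (rule o_bij[where g = "\<lambda>(k, l). (1 - k, l)"]) (auto simp: fun_eq_iff)
  qed (auto simp: parity_sign_def theta_exp_def field_simps)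
  moreover have "theta 1 2 3 * theta (- 1) 1 9 = (\<Sum>r\<in>{0, 1, 2}. ?G r)"
    by (rule theta_mult_split[OF _ _ _ bij_betw_index_3]) simp_all
  ultimately show ?thesis
    by (simp add: algebra_simps fps_const_neg[symmetric] del: fps_const_neg)
qed

text \<open>In the next two proofs the change of indices is division by the Gaussian integer \<open>2 + \<i>\<close>.\<close>

lemma theta_1_0_square:
  "theta 1 1 0 ^ 2 = fps_X * theta 1 5 0 ^ 2 + 4 * theta 1 2 3 * theta 1 1 4"
proof -
  let ?G = "\<lambda>r. gen_series (\<lambda>y. case case y of (j, k) \<Rightarrow> (j + 2 * k + r - 1, 2 * j - k) of (m, n) \<Rightarrow> parity_sign 1 m * parity_sign 1 n)
    (\<lambda>y. case case y of (j, k) \<Rightarrow> (j + 2 * k + r - 1, 2 * j - k) of (m, n) \<Rightarrow> theta_exp 1 0 m + theta_exp 1 0 n)"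
  have "?G 0 = fps_const 1 * fps_X ^ 0 * (theta 1 2 3 * theta 1 1 4)"
    by (rule gen_series_eq_theta_mult[where u = "- 1" and t = 0 and u' = 1 and t' = 0])
      (simp_all add: parity_sign_def theta_exp_def field_simps)
  moreover have "?G 1 = fps_const 1 * fps_X ^ 0 * (theta 1 1 4 * theta 1 2 3)"
    by (rule gen_series_eq_theta_mult[where u = "- 1" and t = 0 and u' = "- 1" and t' = 0])
      (simp_all add: parity_sign_def theta_exp_def field_simps)
  moreover have "?G 2 = fps_const 1 * fps_X ^ 1 * (theta 1 5 0 * theta 1 5 0)"
    by (rule gen_series_eq_theta_mult[where u = 1 and t = 0 and u' = 1 and t' = 0])
      (simp_all add: parity_sign_def theta_exp_def field_simps)
  moreover have "?G 3 = fps_const 1 * fps_X ^ 0 * (theta 1 1 4 * theta 1 2 3)"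
    by (rule gen_series_eq_theta_mult[where u = 1 and t = 1 and u' = 1 and t' = 1])
      (simp_all add: parity_sign_def theta_exp_def field_simps)
  moreover have "?G 4 = fps_const 1 * fps_X ^ 0 * (theta 1 2 3 * theta 1 1 4)"
    by (rule gen_series_eq_theta_mult[where u = 1 and t = 1 and u' = "- 1" and t' = "- 1"])
      (simp_all add: parity_sign_def theta_exp_def field_simps)
  moreover have "theta 1 1 0 * theta 1 1 0 = (\<Sum>r\<in>{0, 1, 2, 3, 4}. ?G r)"
    by (rule theta_mult_split[OF _ _ _ bij_betw_index_5]) simp_all
  ultimately show ?thesis
    by (simp add: power2_eq_square algebra_simps fps_const_neg[symmetric] del: fps_const_neg)
qed

lemma theta_1_1_square:
  "theta (- 1) 1 1 ^ 2 = theta (- 1) 5 5 ^ 2 - 4 * fps_X * theta (- 1) 1 9 * theta (- 1) 3 7"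
proof -
  let ?G = "\<lambda>r. gen_series (\<lambda>y. case case y of (j, k) \<Rightarrow> (j + 2 * k + r - 0, 2 * j - k) of (m, n) \<Rightarrow> parity_sign (- 1) m * parity_sign (- 1) n)
    (\<lambda>y. case case y of (j, k) \<Rightarrow> (j + 2 * k + r - 0, 2 * j - k) of (m, n) \<Rightarrow> theta_exp 1 1 m + theta_exp 1 1 n)"
  have "?G 0 = fps_const 1 * fps_X ^ 0 * (theta (- 1) 5 5 * theta (- 1) 5 5)"
    by (rule gen_series_eq_theta_mult[where u = 1 and t = 0 and u' = 1 and t' = 0])
      (simp_all add: parity_sign_def theta_exp_def field_simps)
  moreover have "?G 1 = fps_const (- 1) * fps_X ^ 1 * (theta (- 1) 3 7 * theta (- 1) 1 9)"
    by (rule gen_series_eq_theta_mult[where u = "- 1" and t = 0 and u' = "- 1" and t' = 0])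
      (simp_all add: parity_sign_def theta_exp_def field_simps)
  moreover have "?G 2 = fps_const (- 1) * fps_X ^ 1 * (theta (- 1) 1 9 * theta (- 1) 3 7)"
    by (rule gen_series_eq_theta_mult[where u = "- 1" and t = 0 and u' = 1 and t' = 1])
      (simp_all add: parity_sign_def theta_exp_def field_simps)
  moreover have "?G 3 = fps_const (- 1) * fps_X ^ 1 * (theta (- 1) 1 9 * theta (- 1) 3 7)"
    by (rule gen_series_eq_theta_mult[where u = 1 and t = 1 and u' = "- 1" and t' = "- 1"])
      (simp_all add: parity_sign_def theta_exp_def field_simps)
  moreover have "?G 4 = fps_const (- 1) * fps_X ^ 1 * (theta (- 1) 3 7 * theta (- 1) 1 9)"
    by (rule gen_series_eq_theta_mult[where u = 1 and t = 1 and u' = 1 and t' = 2])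
      (simp_all add: parity_sign_def theta_exp_def field_simps)
  moreover have "theta (- 1) 1 1 * theta (- 1) 1 1 = (\<Sum>r\<in>{0, 1, 2, 3, 4}. ?G r)"
    by (rule theta_mult_split[OF _ _ _ bij_betw_index_5]) simp_all
  ultimately show ?thesis
    by (simp add: power2_eq_square algebra_simps fps_const_neg[symmetric] del: fps_const_neg)
qed

section \<open>The level 10 function field\<close>

text \<open>Below, \<open>a1\<close>, \<open>a2\<close>, \<open>c1\<close>, ..., \<open>c4\<close> stand for \<open>theta (-1) 1 4\<close>, \<open>theta (-1) 2 3\<close>, \<open>theta (-1) 1 9\<close>, ...,
  \<open>theta (-1) 4 6\<close>, and \<open>A\<close>, \<open>B\<close> for \<open>theta 1 2 3\<close>, \<open>theta 1 1 4\<close>. With the Rogers-Ramanujan continued fraction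
  \<open>R(q) = q^(1/5) a1 / a2\<close>, the parameter \<open>K\<close> of the proof is \<open>R(q) R(q^2)^2\<close>.\<close>

lemma level_10_identity:
  fixes X :: "'a::field"
  assumes nz: "X \<noteq> 0" "f5 \<noteq> 0" "f10 \<noteq> 0" "a1 \<noteq> 0" "a2 \<noteq> 0" "c2 \<noteq> 0" "c4 \<noteq> 0" "(4::'a) \<noteq> 0"
    and f1_def: "f1 = a1 * a2 / f5" and f2_def: "f2 = c2 * c4 / f10"
    and c3_def: "c3 = f10\<^sup>2 * a2 / (c2 * f5)" and c1_def: "c1 = f10\<^sup>2 * a1 / (c4 * f5)"
    and A_def: "A = f5\<^sup>2 * c4 / (a2 * f10)" and B_def: "B = f5\<^sup>2 * c2 / (a1 * f10)"
    and E0_def: "E0 = f5 * a2 / a1" and E2_def: "E2 = f5 * a1 / a2"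
    and plus: "B * a2 = c3 * c4 + X * (c2 * c1)" and minus: "A * a1 = c3 * c4 - X * (c2 * c1)"
    and psi: "(2 * f2\<^sup>2 / f1)\<^sup>2 = X * (2 * f10\<^sup>2 / f5)\<^sup>2 + 4 * A * B"
    and phi: "(f1\<^sup>2 / f2)\<^sup>2 = (f5\<^sup>2 / f10)\<^sup>2 - 4 * X * c1 * c3"
    and U: "U * (E0 ^ 5 - 11 * X * f5 ^ 5 - X\<^sup>2 * E2 ^ 5) =
    A * (2 * E0\<^sup>2 * f5\<^sup>2 - X * f5 * E2 ^ 3) + B * (E0 ^ 3 * f5 + 2 * X * f5\<^sup>2 * E2\<^sup>2) + 5 * X * f10\<^sup>2 * f5 ^ 3"
  shows "U = 3 * (f2 ^ 4 * f5 ^ 6 / (f1 ^ 8 * f10\<^sup>2)) + 8 * X * (f2 ^ 3 * f5 * f10 ^ 3 / f1 ^ 7)"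
proof -
  \<comment> \<open>By the formulas for \<open>c1\<close> and \<open>c3\<close>, \<open>K\<close> is
    the quotient of the two terms on the right of \<open>plus\<close> and \<open>minus\<close>: they
    read B a2 = (1 + K) c3 c4 and A a1 = (1 - K) c3 c4.\<close>
  define K where "K = X * a1 * c2\<^sup>2 / (a2 * c4\<^sup>2)"
  have K: "K * a2 * c4\<^sup>2 = X * a1 * c2\<^sup>2" using nz by (simp add: K_def)
  have p: "f5 ^ 3 * c2\<^sup>2 * a2 * c4 = f10 ^ 3 * a1 * (a2 * c4\<^sup>2 + X * a1 * c2\<^sup>2)"
    using plus nz unfolding B_def c3_def c1_def by (simp add: divide_simps) algebra
  then have "a2 * c4 * ((1 + K) * f10 ^ 3 * a1 * c4) = a2 * c4 * (f5 ^ 3 * c2\<^sup>2)"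
    unfolding K[symmetric] by algebra
  then have 1: "(1 + K) * f10 ^ 3 * a1 * c4 = f5 ^ 3 * c2\<^sup>2" using nz by simp
  have m: "f5 ^ 3 * a1 * c2 * c4\<^sup>2 = f10 ^ 3 * a2 * (a2 * c4\<^sup>2 - X * a1 * c2\<^sup>2)"
    using minus nz unfolding A_def c3_def c1_def by (simp add: divide_simps) algebra
  then have "c4\<^sup>2 * ((1 - K) * f10 ^ 3 * a2\<^sup>2) = c4\<^sup>2 * (f5 ^ 3 * a1 * c2)"
    unfolding K[symmetric] by algebra
  then have 2: "(1 - K) * f10 ^ 3 * a2\<^sup>2 = f5 ^ 3 * a1 * c2" using nz by simp
  have nK: "K \<noteq> 0" "1 + K \<noteq> 0" "1 - K \<noteq> 0" using 1 2 nz by (auto simp: K_def)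
  \<comment> \<open>In the product of 1 and 2, combined with the definition of \<open>K\<close>, the
    level 5 and 10 thetas can be grouped into a1 a2 and c2 c4, that is, into f1 and f2.\<close>
  have "(1 - K\<^sup>2) * X * f1 * f10 ^ 6 * (f5 * c4 * a2 * c4\<^sup>2) = f2 * f10 * f5 ^ 5 * K * (f5 * c4 * a2 * c4\<^sup>2)"
  proof -
    have f: "f1 * f5 = a1 * a2" "f2 * f10 = c2 * c4" using nz by (simp_all add: f1_def f2_def)
    have "(1 - K\<^sup>2) * X * f1 * f10 ^ 6 * (f5 * c4 * a2 * c4\<^sup>2) =
      ((1 + K) * f10 ^ 3 * a1 * c4) * ((1 - K) * f10 ^ 3 * a2\<^sup>2) * X * c4\<^sup>2"
      using f by algebra
    also have "\<dots> = f5 ^ 6 * c2 * c4\<^sup>2 * (X * a1 * c2\<^sup>2)" unfolding 1 2 by algebra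
    also have "\<dots> = f5 ^ 6 * c2 * c4\<^sup>2 * (K * a2 * c4\<^sup>2)" unfolding K ..
    also have "\<dots> = f2 * f10 * f5 ^ 5 * K * (f5 * c4 * a2 * c4\<^sup>2)" using f by algebra
    finally show ?thesis .
  qed
  then have "(1 - K\<^sup>2) * X * f1 * f10 ^ 6 = f2 * f10 * f5 ^ 5 * K" using nz by simp
  then have "f10 * ((1 - K\<^sup>2) * X * f1 * f10 ^ 5) = f10 * (f2 * f5 ^ 5 * K)" by algebra
  then have 3: "f2 * f5 ^ 5 * K = (1 - K\<^sup>2) * X * f1 * f10 ^ 5" using nz by simp
  have f12: "f1 \<noteq> 0" "f2 \<noteq> 0" using nz by (simp_all add: f1_def f2_def)
  have AB: "A * B = f5 ^ 3 * f2 / (f1 * f10)"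
    using nz by (simp add: A_def B_def f1_def f2_def divide_simps power2_eq_square power3_eq_cube)
  have "4 * (f2 ^ 4 * f5\<^sup>2 * f10) = 4 * (X * f10 ^ 5 * f1\<^sup>2 + f5 ^ 5 * f2 * f1)"
    using psi nz f12 unfolding mult.assoc AB by (simp add: divide_simps) algebra
  then have ps: "f2 ^ 4 * f5\<^sup>2 * f10 = X * f10 ^ 5 * f1\<^sup>2 + f5 ^ 5 * f2 * f1"
    unfolding mult_left_cancel[OF nz(8)] .
  \<comment> \<open>Relation 3 trades f5^5 f2 K for a multiple of 1 - K^2, so the two terms of
    \<open>ps\<close> merge into one; \<open>ph\<close> is treated alike below.\<close>
  have "f10 * (f2 ^ 4 * f5\<^sup>2 * K) = f10 * ((1 + K - K\<^sup>2) * X * f1\<^sup>2 * f10 ^ 4)"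
    using ps 3 by algebra
  then have 4: "f2 ^ 4 * f5\<^sup>2 * K = (1 + K - K\<^sup>2) * X * f1\<^sup>2 * f10 ^ 4" using nz by simp
  have cc: "c1 * c3 = f10 ^ 3 * f1 / (f5 * f2)"
    using nz by (simp add: c1_def c3_def f1_def f2_def divide_simps power2_eq_square power3_eq_cube)
  have ph: "f1 ^ 4 * f10\<^sup>2 * f5 = f5 ^ 5 * f2\<^sup>2 - 4 * X * f10 ^ 5 * f1 * f2"
    using phi nz f12 unfolding mult.assoc cc by (simp add: divide_simps) algebra
  have "f5 * (f1 ^ 4 * f10\<^sup>2 * (1 - K\<^sup>2)) = f5 * ((1 - 4 * K - K\<^sup>2) * f2\<^sup>2 * f5 ^ 4)"
    using ph 3 by algebra
  then have 5: "f1 ^ 4 * f10\<^sup>2 * (1 - K\<^sup>2) = (1 - 4 * K - K\<^sup>2) * f2\<^sup>2 * f5 ^ 4" using nz by simp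
  \<comment> \<open>Comparing the squares of 1 and 2 gives Ramanujan's R^5 = K ((1 - K) / (1 +
    K))^2, where R^5 = X (a1 / a2)^5.\<close>
  have "(f10 ^ 6 * a1 * c4\<^sup>2) * (X * a1 ^ 5 * (1 + K)\<^sup>2) = X * a1 ^ 4 * ((1 + K) * f10 ^ 3 * a1 * c4)\<^sup>2"
    by algebra
  also have "\<dots> = X * a1 ^ 4 * (f5 ^ 3 * c2\<^sup>2)\<^sup>2" unfolding 1 ..
  also have "\<dots> = (X * a1 * c2\<^sup>2) * a1 * (f5 ^ 3 * a1 * c2)\<^sup>2" by algebra
  also have "\<dots> = (K * a2 * c4\<^sup>2) * a1 * ((1 - K) * f10 ^ 3 * a2\<^sup>2)\<^sup>2" unfolding K 2 ..
  also have "\<dots> = (f10 ^ 6 * a1 * c4\<^sup>2) * (K * (1 - K)\<^sup>2 * a2 ^ 5)" by algebra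
  finally have 6: "X * a1 ^ 5 * (1 + K)\<^sup>2 = K * (1 - K)\<^sup>2 * a2 ^ 5" using nz by simp
  have "1 - K\<^sup>2 = (1 + K) * (1 - K)" by algebra
  then have nK2: "1 - K\<^sup>2 \<noteq> 0" using nK by simp

  \<comment> \<open>Relation 4 times the square of relation 5 eliminates f2.\<close>
  have f1_6: "f1 ^ 6 * (K * (1 - K\<^sup>2)\<^sup>2) = X * (1 + K - K\<^sup>2) * (1 - 4 * K - K\<^sup>2)\<^sup>2 * f5 ^ 6"
  proof -
    have "(f2 ^ 4 * f5\<^sup>2 * f1\<^sup>2 * f10 ^ 4) * (f1 ^ 6 * (K * (1 - K\<^sup>2)\<^sup>2)) =
        (f2 ^ 4 * f5\<^sup>2 * K) * (f1 ^ 4 * f10\<^sup>2 * (1 - K\<^sup>2))\<^sup>2" by algebra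
    also have "\<dots> = ((1 + K - K\<^sup>2) * X * f1\<^sup>2 * f10 ^ 4) * ((1 - 4 * K - K\<^sup>2) * f2\<^sup>2 * f5 ^ 4)\<^sup>2"
      unfolding 4 5 ..
    also have "\<dots> = (f2 ^ 4 * f5\<^sup>2 * f1\<^sup>2 * f10 ^ 4) * (X * (1 + K - K\<^sup>2) * (1 - 4 * K - K\<^sup>2)\<^sup>2 * f5 ^ 6)"
      by algebra
    finally show ?thesis using nz f12 by simp
  qed
  \<comment> \<open>Via 6 this evaluates 1/R^5 - 11 - R^5 in terms of \<open>K\<close>; the same
    expression occurs in \<open>f1_6\<close>, so the norm is a power of f1 over f5.\<close>
  have "(K * (1 - K\<^sup>2)\<^sup>2) * (a2 ^ 10 - 11 * X * a1 ^ 5 * a2 ^ 5 - X\<^sup>2 * a1 ^ 10) =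
      a1 ^ 5 * a2 ^ 5 * (X * (1 + K - K\<^sup>2) * (1 - 4 * K - K\<^sup>2)\<^sup>2)"
  proof -
    have "(K * (1 - K\<^sup>2)\<^sup>2) * (a2 ^ 10 - 11 * X * a1 ^ 5 * a2 ^ 5 - X\<^sup>2 * a1 ^ 10) =
      (K * (1 - K)\<^sup>2 * a2 ^ 5) * (1 + K)\<^sup>2 * a2 ^ 5 - 11 * X * a1 ^ 5 * a2 ^ 5 * K * (1 - K\<^sup>2)\<^sup>2
      - (X * a1 ^ 5 * (1 + K)\<^sup>2) * X * a1 ^ 5 * K * (1 - K)\<^sup>2" by algebra
    also have "\<dots> = (X * a1 ^ 5 * (1 + K)\<^sup>2) * (1 + K)\<^sup>2 * a2 ^ 5 - 11 * X * a1 ^ 5 * a2 ^ 5 * K * (1 - K\<^sup>2)\<^sup>2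
      - (K * (1 - K)\<^sup>2 * a2 ^ 5) * X * a1 ^ 5 * K * (1 - K)\<^sup>2" unfolding 6 ..
    also have "\<dots> = a1 ^ 5 * a2 ^ 5 * (X * (1 + K - K\<^sup>2) * (1 - 4 * K - K\<^sup>2)\<^sup>2)" by algebra
    finally show ?thesis .
  qed
  then have "(K * (1 - K\<^sup>2)\<^sup>2) * (f5 ^ 6 * (a2 ^ 10 - 11 * X * a1 ^ 5 * a2 ^ 5 - X\<^sup>2 * a1 ^ 10)) =
      (K * (1 - K\<^sup>2)\<^sup>2) * (f1 ^ 6 * a1 ^ 5 * a2 ^ 5)"
    using f1_6 by algebra
  then have "f5 ^ 6 * (a2 ^ 10 - 11 * X * a1 ^ 5 * a2 ^ 5 - X\<^sup>2 * a1 ^ 10) = f1 ^ 6 * a1 ^ 5 * a2 ^ 5"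
    using nK nK2 by simp
  moreover have "(E0 ^ 5 - 11 * X * f5 ^ 5 - X\<^sup>2 * E2 ^ 5) * (a1 ^ 5 * a2 ^ 5) =
      f5 ^ 5 * (a2 ^ 10 - 11 * X * a1 ^ 5 * a2 ^ 5 - X\<^sup>2 * a1 ^ 10)"
    using nz by (simp add: E0_def E2_def power_divide divide_simps) algebra
  ultimately have "(a1 ^ 5 * a2 ^ 5) * (f5 * (E0 ^ 5 - 11 * X * f5 ^ 5 - X\<^sup>2 * E2 ^ 5)) = (a1 ^ 5 * a2 ^ 5) * f1 ^ 6"
    by algebra
  then have norm: "f5 * (E0 ^ 5 - 11 * X * f5 ^ 5 - X\<^sup>2 * E2 ^ 5) = f1 ^ 6"
    using nz by simp

  \<comment> \<open>\<open>L\<close> is the common scale: every term of \<open>U\<close> times the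
    norm becomes \<open>L\<close> times a rational function of \<open>K\<close>. Here \<rho> and
    \<sigma> are the two quotients of the claim, the second with its factor X, multiplied by f1^6 /
    f5.\<close>
  define L where "L = X * f10\<^sup>2 * f5 ^ 3"
  define \<alpha> where "\<alpha> = A * E0\<^sup>2 * f5\<^sup>2"
  define \<gamma> where "\<gamma> = B * E0 ^ 3 * f5"
  define \<rho> where "\<rho> = f2 ^ 4 * f5 ^ 5 / (f1\<^sup>2 * f10\<^sup>2)"
  define \<sigma> where "\<sigma> = X * f2 ^ 3 * f10 ^ 3 / f1"
  have \<alpha>': "\<alpha> * f10 * a1\<^sup>2 = f5 ^ 6 * c4 * a2"
    using nz by (simp add: \<alpha>_def A_def E0_def power_divide divide_simps) algebra
  have \<gamma>': "\<gamma> * f10 * a1 ^ 4 = f5 ^ 6 * c2 * a2 ^ 3"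
    using nz by (simp add: \<gamma>_def B_def E0_def power_divide divide_simps) algebra
  have "(f10 * a1\<^sup>2 * c4) * (\<alpha> * K) = (\<alpha> * f10 * a1\<^sup>2) * c4 * K" by algebra
  also have "\<dots> = f5 ^ 6 * (K * a2 * c4\<^sup>2)" unfolding \<alpha>' by algebra
  also have "\<dots> = f5 ^ 3 * X * a1 * (f5 ^ 3 * c2\<^sup>2)" unfolding K by algebra
  also have "\<dots> = (f10 * a1\<^sup>2 * c4) * (L * (1 + K))" unfolding 1[symmetric] L_def by algebra
  finally have \<alpha>: "\<alpha> * K = L * (1 + K)" using nz by simp
  have "(f5 ^ 3 * f10 ^ 3 * c2) * ((1 + K) * a1\<^sup>2 * c4) = ((1 + K) * f10 ^ 3 * a1 * c4) * (f5 ^ 3 * a1 * c2)"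
    by algebra
  also have "\<dots> = (f5 ^ 3 * f10 ^ 3 * c2) * ((1 - K) * a2\<^sup>2 * c2)" unfolding 1 2[symmetric] by algebra
  finally have \<kappa>: "(1 + K) * a1\<^sup>2 * c4 = (1 - K) * a2\<^sup>2 * c2" using nz by simp
  have "(f10 * a1 ^ 4) * (\<gamma> * (1 - K)) = f5 ^ 6 * a2 * ((1 - K) * a2\<^sup>2 * c2)" using \<gamma>' by algebra
  also have "\<dots> = (f10 * a1 ^ 4) * (\<alpha> * (1 + K))" unfolding \<kappa>[symmetric] using \<alpha>' by algebra
  finally have \<gamma>: "\<gamma> * (1 - K) = \<alpha> * (1 + K)" using nz by simp
  have XE: "X * E2 ^ 5 * (1 + K)\<^sup>2 = K * (1 - K)\<^sup>2 * f5 ^ 5"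
    using 6 nz by (simp add: E2_def power_divide divide_simps) algebra
  have EE: "E0 * E2 = f5\<^sup>2" using nz by (simp add: E0_def E2_def power2_eq_square)
  have n5: "f5 ^ 5 \<noteq> 0" using nz by simp
  \<comment> \<open>Since E0 E2 = f5^2, powers of E2 can be raised to E2^5 at the cost of powers of
    E0, and \<open>XE\<close> then removes E2 altogether.\<close>
  have "f5 ^ 5 * (X * f5 * A * E2 ^ 3 * (1 + K)\<^sup>2) = f5\<^sup>2 * A * E0\<^sup>2 * (X * E2 ^ 5 * (1 + K)\<^sup>2)"
    using EE by algebra
  also have "\<dots> = f5 ^ 5 * (\<alpha> * K * (1 - K)\<^sup>2)" unfolding XE \<alpha>_def by algebra
  finally have \<beta>: "X * f5 * A * E2 ^ 3 * (1 + K)\<^sup>2 = \<alpha> * K * (1 - K)\<^sup>2" using n5 by simp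
  have "f5 ^ 5 * (X * f5\<^sup>2 * B * E2\<^sup>2 * (1 + K)\<^sup>2) = f5 * B * E0 ^ 3 * (X * E2 ^ 5 * (1 + K)\<^sup>2)"
    using EE by algebra
  also have "\<dots> = f5 ^ 5 * (\<gamma> * K * (1 - K)\<^sup>2)" unfolding XE \<gamma>_def by algebra
  finally have \<delta>: "X * f5\<^sup>2 * B * E2\<^sup>2 * (1 + K)\<^sup>2 = \<gamma> * K * (1 - K)\<^sup>2" using n5 by simp
  have \<rho>: "\<rho> * K = (1 + K - K\<^sup>2) * L"
    using 4 nz f12 by (simp add: \<rho>_def L_def divide_simps) algebra
  have \<sigma>: "\<sigma> * (1 - K\<^sup>2) = \<rho> * K"
    using 3 nz f12 by (simp add: \<rho>_def \<sigma>_def divide_simps) algebra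
  have "A * (2 * E0\<^sup>2 * f5\<^sup>2 - X * f5 * E2 ^ 3) + B * (E0 ^ 3 * f5 + 2 * X * f5\<^sup>2 * E2\<^sup>2) + 5 * X * f10\<^sup>2 * f5 ^ 3
      = 2 * \<alpha> - X * f5 * A * E2 ^ 3 + \<gamma> + 2 * (X * f5\<^sup>2 * B * E2\<^sup>2) + 5 * L"
    unfolding \<alpha>_def \<gamma>_def L_def by algebra
  also have "\<dots> = 3 * \<rho> + 8 * \<sigma>"
  proof -
    have \<alpha>1: "\<alpha> = L * (1 + K) / K" using \<alpha> nK by (simp add: divide_simps)
    have \<gamma>1: "\<gamma> = L * (1 + K)\<^sup>2 / (K * (1 - K))"
      using \<gamma> nK unfolding \<alpha>1 by (simp add: divide_simps power2_eq_square) algebra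
    have \<beta>1: "X * f5 * A * E2 ^ 3 = L * (1 - K)\<^sup>2 / (1 + K)"
      using \<beta> nK unfolding \<alpha>1 by (simp add: divide_simps power2_eq_square) algebra
    have \<delta>1: "X * f5\<^sup>2 * B * E2\<^sup>2 = L * (1 - K)"
      using \<delta> nK unfolding \<gamma>1 by (simp add: divide_simps power2_eq_square) algebra
    have \<rho>1: "\<rho> = (1 + K - K\<^sup>2) * L / K" using \<rho> nK by (simp add: divide_simps)
    have \<sigma>1: "\<sigma> = (1 + K - K\<^sup>2) * L / ((1 + K) * (1 - K))"
      using \<sigma> \<rho> nK \<open>1 - K\<^sup>2 = (1 + K) * (1 - K)\<close> by (simp add: divide_simps)
    \<comment> \<open>Over the denominator K (1 - K^2) both sides have the numerator L (3 + 11 K + 2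
      K^2 - 11 K^3 + 3 K^4).\<close>
    show ?thesis unfolding \<alpha>1 \<gamma>1 \<beta>1 \<delta>1 \<rho>1 \<sigma>1 using nK by (simp add: divide_simps) algebra
  qed
  finally have "U * f1 ^ 6 = f5 * (3 * \<rho> + 8 * \<sigma>)" using U norm by algebra
  then have "U = f5 * (3 * \<rho> + 8 * \<sigma>) / f1 ^ 6" using f12 by (simp add: divide_simps)
  also have "\<dots> = 3 * (f5 * \<rho> / f1 ^ 6) + 8 * (f5 * \<sigma> / f1 ^ 6)" by (simp add: add_divide_distrib distrib_left ac_simps)
  also have "f5 * \<rho> / f1 ^ 6 = f2 ^ 4 * f5 ^ 6 / (f1 ^ 8 * f10\<^sup>2)"
    unfolding \<rho>_def using nz f12 by (simp add: divide_simps) algebra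
  also have "f5 * \<sigma> / f1 ^ 6 = X * (f2 ^ 3 * f5 * f10 ^ 3 / f1 ^ 7)"
    unfolding \<sigma>_def using nz f12 by (simp add: divide_simps) algebra
  finally show ?thesis by (simp add: mult.assoc)
qed

section \<open>The residue class 2 modulo 5\<close>

abbreviation dilate :: "rat fps \<Rightarrow> rat fps" where
  "dilate f \<equiv> f oo fps_X ^ 5"

definition section_2_mod_5 :: "rat fps \<Rightarrow> rat fps" where
  "section_2_mod_5 f = Abs_fps (\<lambda>n. fps_nth f (5 * n + 2))"

lemma section_2_mod_5_add: "section_2_mod_5 (f + g) = section_2_mod_5 f + section_2_mod_5 g"
  by (rule fps_ext) (simp add: section_2_mod_5_def)

text \<open>Multiplication by a series in q^5 preserves residue classes of exponents, so the section
  is linear over such series.\<close>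

lemma section_2_mod_5_mult_dilate: "section_2_mod_5 (f * dilate g) = section_2_mod_5 f * g"
proof (rule fps_ext)
  fix n
  have "fps_nth (section_2_mod_5 (f * dilate g)) n =
      (\<Sum>i=0..5 * n + 2. if 5 dvd i then fps_nth g (i div 5) * fps_nth f (5 * n + 2 - i) else 0)"
    unfolding mult.commute[of f] section_2_mod_5_def
    by (simp add: fps_mult_nth fps_nth_compose_X_power if_distrib[of "\<lambda>x. x * _"] cong: if_cong)
  also have "\<dots> = (\<Sum>i | i \<in> {0..5 * n + 2} \<and> 5 dvd i. fps_nth g (i div 5) * fps_nth f (5 * n + 2 - i))"
    by (rule sum.inter_filter[symmetric]) simp
  also have "\<dots> = (\<Sum>i=0..n. fps_nth g i * fps_nth f (5 * (n - i) + 2))"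
  proof (rule sum.reindex_bij_witness[of _ "\<lambda>i. 5 * i" "\<lambda>i. i div 5"], goal_cases)
    case (5 i)
    then have "5 * (n - i div 5) + 2 = 5 * n + 2 - i" by (auto elim!: dvdE)
    then show ?case by simp
  qed auto
  also have "\<dots> = fps_nth (section_2_mod_5 f * g) n"
    unfolding mult.commute[of _ g] by (simp add: fps_mult_nth section_2_mod_5_def)
  finally show "fps_nth (section_2_mod_5 (f * dilate g)) n = \<dots>" .
qed

lemma section_2_mod_5_monomial:
  "section_2_mod_5 (fps_X ^ j * dilate g) = (if j mod 5 = 2 then fps_X ^ (j div 5) * g else 0)"
proof -
  have "section_2_mod_5 (fps_X ^ j) = (if j mod 5 = 2 then fps_X ^ (j div 5) else 0)"
  proof (rule fps_ext)
    fix n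
    have "5 * n + 2 = j \<longleftrightarrow> j mod 5 = 2 \<and> n = j div 5" by presburger
    then show "fps_nth (section_2_mod_5 (fps_X ^ j)) n =
        fps_nth (if j mod 5 = 2 then fps_X ^ (j div 5) else 0) n"
      by (auto simp: section_2_mod_5_def fps_X_power_nth)
  qed
  then show ?thesis by (simp add: section_2_mod_5_mult_dilate)
qed

lemmas dilate_simps = fps_compose_add_distrib fps_compose_sub_distrib fps_compose_mult_distrib
  fps_compose_power[symmetric]

lemma dilate_X: "dilate fps_X = fps_X ^ 5"
  by (rule fps_ext) (auto simp: fps_nth_compose_X_power fps_X_power_nth)

lemma dilate_numeral: "dilate (numeral n) = numeral n"
  by (simp add: numeral_fps_const)

lemma theta_5_0_mult_euler_f: "theta 1 5 0 * euler_f 5 = 2 * euler_f 10 ^ 2"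
  using arg_cong[OF theta_1_0_mult_euler_f, of dilate]
  by (simp add: fps_compose_mult_distrib dilate_numeral theta_compose euler_f_compose flip: fps_compose_power)

lemma fps_X_power_5_nth_0: "fps_nth (fps_X ^ 5 :: rat fps) 0 = 0"
  by simp

lemma euler_f_nonzero: "k > 0 \<Longrightarrow> euler_f k \<noteq> 0"
  using euler_f_nth_0[of k] by auto

lemma theta_nonzero: "theta (- 1) 1 4 \<noteq> 0" "theta (- 1) 2 3 \<noteq> 0" "theta (- 1) 2 8 \<noteq> 0" "theta (- 1) 4 6 \<noteq> 0"
proof -
  have "theta (- 1) 1 4 * theta (- 1) 2 3 \<noteq> 0" "theta (- 1) 2 8 * theta (- 1) 4 6 \<noteq> 0"
    by (simp_all only: theta_1_4_mult_theta_2_3 theta_2_8_mult_theta_4_6) (simp_all add: euler_f_nonzero)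
  then show "theta (- 1) 1 4 \<noteq> 0" "theta (- 1) 2 3 \<noteq> 0" "theta (- 1) 2 8 \<noteq> 0" "theta (- 1) 4 6 \<noteq> 0"
    by auto
qed

text \<open>The quintuple product evaluations give the outer parts of f_1 in closed form, once the
  positive-sign theta is eliminated; their product is the geometric progression.\<close>

lemma theta_ratio:
  defines "E0 \<equiv> theta (- 1) 7 8 + fps_X * theta (- 1) 2 13"
    and "E2 \<equiv> theta (- 1) 4 11 - fps_X * theta (- 1) 1 14"
  shows "E0 * theta (- 1) 1 4 = euler_f 5 * theta (- 1) 2 3"
    and "E2 * theta (- 1) 2 3 = euler_f 5 * theta (- 1) 1 4"
    and "E0 * E2 = euler_f 5 ^ 2"
proof -
  let ?a1 = "theta (- 1) 1 4" and ?a2 = "theta (- 1) 2 3" and ?c2 = "theta (- 1) 2 8" and ?c4 = "theta (- 1) 4 6"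
  have f10: "theta (- 1) 10 20 = euler_f 10" by (simp add: euler_f_eq_theta)
  have "E0 * ?a1 * (euler_f 10 ^ 2 * ?c2 * euler_f 5) = euler_f 5 * ?a2 * (euler_f 10 ^ 2 * ?c2 * euler_f 5)"
    using theta_1_4_mult_theta_3_7 theta_1_4_pos_mult_neg theta_3_7_mult_theta_2_8
    unfolding f10 E0_def[symmetric] by algebra
  then show E0: "E0 * ?a1 = euler_f 5 * ?a2"
    by (simp add: euler_f_nonzero theta_nonzero)
  have "E2 * ?a2 * (euler_f 10 ^ 2 * ?c4 * euler_f 5) = euler_f 5 * ?a1 * (euler_f 10 ^ 2 * ?c4 * euler_f 5)"
    using theta_2_3_mult_theta_1_9 theta_2_3_pos_mult_neg theta_1_9_mult_theta_4_6
    unfolding f10 E2_def[symmetric] by algebra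
  then show E2: "E2 * ?a2 = euler_f 5 * ?a1"
    by (simp add: euler_f_nonzero theta_nonzero)
  have "E0 * E2 * (?a1 * ?a2) = euler_f 5 ^ 2 * (?a1 * ?a2)" using E0 E2 by algebra
  then show "E0 * E2 = euler_f 5 ^ 2" by (simp add: theta_nonzero del: One_nat_def)
qed

lemma section_2_mod_5_quotient:
  defines "E0 \<equiv> theta (- 1) 7 8 + fps_X * theta (- 1) 2 13"
    and "E2 \<equiv> theta (- 1) 4 11 - fps_X * theta (- 1) 1 14"
  assumes F: "F * euler_f 1 ^ 2 = euler_f 2 ^ 2"
  shows "section_2_mod_5 F * (E0 ^ 5 - 11 * fps_X * euler_f 5 ^ 5 - fps_X ^ 2 * E2 ^ 5) =
    theta 1 2 3 * (2 * E0 ^ 2 * euler_f 5 ^ 2 - fps_X * euler_f 5 * E2 ^ 3)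
    + theta 1 1 4 * (E0 ^ 3 * euler_f 5 + 2 * fps_X * euler_f 5 ^ 2 * E2 ^ 2) + 5 * fps_X * euler_f 10 ^ 2 * euler_f 5 ^ 3"
proof -
  let ?P = "theta 1 1 0" and ?P5 = "theta 1 5 0" and ?A = "theta 1 2 3" and ?B = "theta 1 1 4" and ?f5 = "euler_f 5"
  \<comment> \<open>With y = q e1 / e0, \<open>dilate N\<close> is e0^5 (1 - 11 y^5 - y^10).\<close>
  define N where "N = E0 ^ 5 - 11 * fps_X * ?f5 ^ 5 - fps_X ^ 2 * E2 ^ 5"
  define e0 e1 e2 where "e0 = dilate E0" and "e1 = dilate ?f5" and "e2 = dilate E2"
  have e: "e0 = theta (- 1) 35 40 + fps_X ^ 5 * theta (- 1) 10 65" "e1 = theta (- 1) 25 50"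
      "e2 = theta (- 1) 20 55 - fps_X ^ 5 * theta (- 1) 5 70"
    by (simp_all add: e0_def e1_def e2_def E0_def E2_def dilate_simps dilate_X theta_compose euler_f_eq_theta)
  have f1: "euler_f 1 = e0 - fps_X * e1 - fps_X ^ 2 * e2"
    using theta_1_2_dissection unfolding e by (simp add: euler_f_eq_theta)
  have "e0 * e2 = e1 ^ 2"
    using arg_cong[OF theta_ratio(3), of dilate]
    by (simp add: e0_def e1_def e2_def E0_def E2_def fps_compose_mult_distrib fps_compose_power)
  txt \<open>\<open>W\<close> is the product of the other four conjugates of \<open>euler_f 1\<close> under \<open>q \<mapsto> \<zeta> q\<close> with \<open>\<zeta>^5 = 1\<close>.\<close>
  define W where "W = e0 ^ 4 + fps_X * (e0 ^ 3 * e1) + 2 * fps_X ^ 2 * (e0 ^ 2 * e1 ^ 2) + 3 * fps_X ^ 3 * (e0 * e1 ^ 3)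
    + 5 * fps_X ^ 4 * e1 ^ 4 - 3 * fps_X ^ 5 * (e1 ^ 3 * e2) + 2 * fps_X ^ 6 * (e1 ^ 2 * e2 ^ 2)
    - fps_X ^ 7 * (e1 * e2 ^ 3) + fps_X ^ 8 * e2 ^ 4"
  have dN: "dilate N = e0 ^ 5 - 11 * fps_X ^ 5 * e1 ^ 5 - fps_X ^ 10 * e2 ^ 5"
    by (simp add: N_def e0_def e1_def e2_def dilate_simps dilate_X dilate_numeral flip: power_mult)
  \<comment> \<open>The coefficients of \<open>W\<close> are those of (1 - 11 y^5 - y^10) / (1 - y -
    y^2); up to y^4 they are the Fibonacci numbers 1, 1, 2, 3, 5.\<close>
  have W: "euler_f 1 * W = dilate N"
    using \<open>e0 * e2 = e1 ^ 2\<close> unfolding dN W_def f1 by algebra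
  \<comment> \<open>The terms of \<open>W\<close> sorted by exponent modulo 5, with q^5 already
    replaced by q.\<close>
  define v0 v1 v2 v3 v4 where
    "v0 = E0 ^ 4 - 3 * fps_X * (?f5 ^ 3 * E2)" and
    "v1 = E0 ^ 3 * ?f5 + 2 * fps_X * ?f5 ^ 2 * E2 ^ 2" and
    "v2 = 2 * E0 ^ 2 * ?f5 ^ 2 - fps_X * ?f5 * E2 ^ 3" and
    "v3 = 3 * (E0 * ?f5 ^ 3) + fps_X * E2 ^ 4" and
    "v4 = 5 * ?f5 ^ 4"
  have dv: "dilate v0 = e0 ^ 4 - 3 * fps_X ^ 5 * (e1 ^ 3 * e2)"
      "dilate v1 = e0 ^ 3 * e1 + 2 * fps_X ^ 5 * e1 ^ 2 * e2 ^ 2"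
      "dilate v2 = 2 * e0 ^ 2 * e1 ^ 2 - fps_X ^ 5 * e1 * e2 ^ 3"
      "dilate v3 = 3 * (e0 * e1 ^ 3) + fps_X ^ 5 * e2 ^ 4"
      "dilate v4 = 5 * e1 ^ 4"
    by (simp_all add: v0_def v1_def v2_def v3_def v4_def e0_def e1_def e2_def dilate_simps dilate_X dilate_numeral)
  have Wv: "W = dilate v0 + fps_X * dilate v1 + fps_X ^ 2 * dilate v2 + fps_X ^ 3 * dilate v3 + fps_X ^ 4 * dilate v4"
    unfolding dv W_def by algebra
  have P: "?P = 2 * dilate ?A + 2 * fps_X * dilate ?B + fps_X ^ 3 * dilate ?P5"
    using theta_1_0_dissection by (simp add: theta_compose)
  have d2: "dilate (2 * f) = 2 * dilate f" for f
    by (simp add: dilate_simps dilate_numeral)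
  have PW: "?P * W =
      fps_X ^ 0 * dilate (2 * (?A * v0)) + fps_X ^ 1 * dilate (2 * (?A * v1)) + fps_X ^ 2 * dilate (2 * (?A * v2))
      + fps_X ^ 3 * dilate (2 * (?A * v3)) + fps_X ^ 4 * dilate (2 * (?A * v4))
      + fps_X ^ 1 * dilate (2 * (?B * v0)) + fps_X ^ 2 * dilate (2 * (?B * v1)) + fps_X ^ 3 * dilate (2 * (?B * v2))
      + fps_X ^ 4 * dilate (2 * (?B * v3)) + fps_X ^ 5 * dilate (2 * (?B * v4))
      + fps_X ^ 3 * dilate (?P5 * v0) + fps_X ^ 4 * dilate (?P5 * v1) + fps_X ^ 5 * dilate (?P5 * v2)
      + fps_X ^ 6 * dilate (?P5 * v3) + fps_X ^ 7 * dilate (?P5 * v4)"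
    unfolding Wv d2 unfolding fps_compose_mult_distrib[OF fps_X_power_5_nth_0] by (subst P) algebra
  \<comment> \<open>Exponents 2 modulo 5 arise as 0 + 2, 1 + 1 and 3 + 4; the last is 7 = 5 + 2 and
    leaves a factor \<open>fps_X\<close>.\<close>
  have "section_2_mod_5 (?P * W) = 2 * (?A * v2) + 2 * (?B * v1) + fps_X * (?P5 * v4)"
    unfolding PW section_2_mod_5_add section_2_mod_5_monomial by simp
  moreover have "?P * W = (F + F) * dilate N"
  proof -
    have "euler_f 1 * (?P * W) = euler_f 1 * ((F + F) * dilate N)"
      using F theta_1_0_mult_euler_f W by algebra
    then show ?thesis by (simp add: euler_f_nonzero)
  qed
  ultimately have "2 * (section_2_mod_5 F * N) = 2 * (?A * v2) + 2 * (?B * v1) + fps_X * (?P5 * v4)"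
    by (simp only: section_2_mod_5_mult_dilate section_2_mod_5_add mult_2 distrib_right)
  then have "2 * (section_2_mod_5 F * N) = 2 * (?A * v2 + ?B * v1 + 5 * fps_X * euler_f 10 ^ 2 * ?f5 ^ 3)"
    using theta_5_0_mult_euler_f unfolding v4_def by algebra
  then have "section_2_mod_5 F * N = ?A * v2 + ?B * v1 + 5 * fps_X * euler_f 10 ^ 2 * ?f5 ^ 3"
    by (rule mult_left_cancel[THEN iffD1, rotated]) simp
  then show ?thesis unfolding N_def v1_def v2_def .
qed

lemma section_2_mod_5_quotient_eq:
  assumes F: "F * euler_f 1 ^ 2 = euler_f 2 ^ 2"
  shows "section_2_mod_5 F =
    3 * (euler_f 2 ^ 4 * euler_f 5 ^ 6 / (euler_f 1 ^ 8 * euler_f 10 ^ 2))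
    + 8 * fps_X * (euler_f 2 ^ 3 * euler_f 5 * euler_f 10 ^ 3 / euler_f 1 ^ 7)"
proof -
  \<comment> \<open>\<open>level_10_identity\<close> needs a field, so all relations are carried
    over to Laurent series.\<close>
  let ?\<phi> = "fps_to_fls :: rat fps \<Rightarrow> rat fls"
  note hom = fls_times_fps_to_fls fps_to_fls_power fps_to_fls_plus fps_to_fls_minus fps_X_to_fls fps_to_fls_numeral
  note nz = euler_f_nonzero theta_nonzero
  have div: "f * g = h \<Longrightarrow> g \<noteq> 0 \<Longrightarrow> ?\<phi> f = ?\<phi> h / ?\<phi> g" for f g h
    by (auto simp: hom)
  define E0 where "E0 = theta (- 1) 7 8 + fps_X * theta (- 1) 2 13"
  define E2 where "E2 = theta (- 1) 4 11 - fps_X * theta (- 1) 1 14"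
  have P: "?\<phi> (theta 1 1 0) = 2 * ?\<phi> (euler_f 2) ^ 2 / ?\<phi> (euler_f 1)"
    using div[OF theta_1_0_mult_euler_f] by (simp add: nz hom del: One_nat_def)
  have P5: "?\<phi> (theta 1 5 0) = 2 * ?\<phi> (euler_f 10) ^ 2 / ?\<phi> (euler_f 5)"
    using div[OF theta_5_0_mult_euler_f] by (simp add: nz hom)
  have H: "?\<phi> (theta (- 1) 1 1) = ?\<phi> (euler_f 1) ^ 2 / ?\<phi> (euler_f 2)"
    using div[OF theta_1_1_mult_euler_f] by (simp add: nz hom del: One_nat_def)
  have H5: "?\<phi> (theta (- 1) 5 5) = ?\<phi> (euler_f 5) ^ 2 / ?\<phi> (euler_f 10)"
  proof -
    have "theta (- 1) 5 5 * euler_f 10 = euler_f 5 ^ 2"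
      using arg_cong[OF theta_1_1_mult_euler_f, of dilate]
      by (simp add: fps_compose_mult_distrib theta_compose euler_f_compose flip: fps_compose_power)
    from div[OF this] show ?thesis by (simp add: nz hom del: One_nat_def)
  qed
  have "?\<phi> (section_2_mod_5 F) =
      3 * (?\<phi> (euler_f 2) ^ 4 * ?\<phi> (euler_f 5) ^ 6 / (?\<phi> (euler_f 1) ^ 8 * (?\<phi> (euler_f 10))\<^sup>2))
      + 8 * fls_X * (?\<phi> (euler_f 2) ^ 3 * ?\<phi> (euler_f 5) * ?\<phi> (euler_f 10) ^ 3 / ?\<phi> (euler_f 1) ^ 7)"
  proof (rule level_10_identity)
    show "?\<phi> (euler_f 1) = ?\<phi> (theta (- 1) 1 4) * ?\<phi> (theta (- 1) 2 3) / ?\<phi> (euler_f 5)"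
      using div[OF theta_1_4_mult_theta_2_3[symmetric]] by (simp add: nz hom del: One_nat_def)
    show "?\<phi> (euler_f 2) = ?\<phi> (theta (- 1) 2 8) * ?\<phi> (theta (- 1) 4 6) / ?\<phi> (euler_f 10)"
      using div[OF theta_2_8_mult_theta_4_6[symmetric]] by (simp add: nz hom del: One_nat_def)
    show "?\<phi> (theta (- 1) 3 7) = (?\<phi> (euler_f 10))\<^sup>2 * ?\<phi> (theta (- 1) 2 3) / (?\<phi> (theta (- 1) 2 8) * ?\<phi> (euler_f 5))"
      using div[OF theta_3_7_mult_theta_2_8[unfolded mult.assoc]] by (simp add: nz hom del: One_nat_def)
    show "?\<phi> (theta (- 1) 1 9) = (?\<phi> (euler_f 10))\<^sup>2 * ?\<phi> (theta (- 1) 1 4) / (?\<phi> (theta (- 1) 4 6) * ?\<phi> (euler_f 5))"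
      using div[OF theta_1_9_mult_theta_4_6[unfolded mult.assoc]] by (simp add: nz hom del: One_nat_def)
    show "?\<phi> (theta 1 2 3) = (?\<phi> (euler_f 5))\<^sup>2 * ?\<phi> (theta (- 1) 4 6) / (?\<phi> (theta (- 1) 2 3) * ?\<phi> (euler_f 10))"
      using div[OF theta_2_3_pos_mult_neg[unfolded mult.assoc]] by (simp add: nz hom del: One_nat_def)
    show "?\<phi> (theta 1 1 4) = (?\<phi> (euler_f 5))\<^sup>2 * ?\<phi> (theta (- 1) 2 8) / (?\<phi> (theta (- 1) 1 4) * ?\<phi> (euler_f 10))"
      using div[OF theta_1_4_pos_mult_neg[unfolded mult.assoc]] by (simp add: nz hom del: One_nat_def)
    show "?\<phi> E0 = ?\<phi> (euler_f 5) * ?\<phi> (theta (- 1) 2 3) / ?\<phi> (theta (- 1) 1 4)"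
      using div[OF theta_ratio(1)] by (simp add: nz hom E0_def del: One_nat_def)
    show "?\<phi> E2 = ?\<phi> (euler_f 5) * ?\<phi> (theta (- 1) 1 4) / ?\<phi> (theta (- 1) 2 3)"
      using div[OF theta_ratio(2)] by (simp add: nz hom E2_def del: One_nat_def)
    show "?\<phi> (theta 1 1 4) * ?\<phi> (theta (- 1) 2 3) = ?\<phi> (theta (- 1) 3 7) * ?\<phi> (theta (- 1) 4 6)
        + fls_X * (?\<phi> (theta (- 1) 2 8) * ?\<phi> (theta (- 1) 1 9))"
      using arg_cong[OF theta_1_4_mult_theta_2_3_neg, of ?\<phi>] by (simp only: hom)
    show "?\<phi> (theta 1 2 3) * ?\<phi> (theta (- 1) 1 4) = ?\<phi> (theta (- 1) 3 7) * ?\<phi> (theta (- 1) 4 6)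
        - fls_X * (?\<phi> (theta (- 1) 2 8) * ?\<phi> (theta (- 1) 1 9))"
      using arg_cong[OF theta_2_3_mult_theta_1_4_neg, of ?\<phi>] by (simp only: hom)
    show "(2 * (?\<phi> (euler_f 2))\<^sup>2 / ?\<phi> (euler_f 1))\<^sup>2 = fls_X * (2 * (?\<phi> (euler_f 10))\<^sup>2 / ?\<phi> (euler_f 5))\<^sup>2
        + 4 * ?\<phi> (theta 1 2 3) * ?\<phi> (theta 1 1 4)"
      using arg_cong[OF theta_1_0_square, of ?\<phi>] unfolding P[symmetric] P5[symmetric] by (simp only: hom)
    show "((?\<phi> (euler_f 1))\<^sup>2 / ?\<phi> (euler_f 2))\<^sup>2 = ((?\<phi> (euler_f 5))\<^sup>2 / ?\<phi> (euler_f 10))\<^sup>2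
        - 4 * fls_X * ?\<phi> (theta (- 1) 1 9) * ?\<phi> (theta (- 1) 3 7)"
      using arg_cong[OF theta_1_1_square, of ?\<phi>] unfolding H[symmetric] H5[symmetric] by (simp only: hom)
    show "?\<phi> (section_2_mod_5 F) * (?\<phi> E0 ^ 5 - 11 * fls_X * ?\<phi> (euler_f 5) ^ 5 - fls_X\<^sup>2 * ?\<phi> E2 ^ 5) =
        ?\<phi> (theta 1 2 3) * (2 * (?\<phi> E0)\<^sup>2 * (?\<phi> (euler_f 5))\<^sup>2 - fls_X * ?\<phi> (euler_f 5) * ?\<phi> E2 ^ 3)
        + ?\<phi> (theta 1 1 4) * (?\<phi> E0 ^ 3 * ?\<phi> (euler_f 5) + 2 * fls_X * (?\<phi> (euler_f 5))\<^sup>2 * (?\<phi> E2)\<^sup>2)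
        + 5 * fls_X * (?\<phi> (euler_f 10))\<^sup>2 * ?\<phi> (euler_f 5) ^ 3"
      using arg_cong[OF section_2_mod_5_quotient[OF F], of ?\<phi>]
      unfolding E0_def[symmetric] E2_def[symmetric] by (simp only: hom)
  qed (simp_all add: nz del: One_nat_def)
  \<comment> \<open>All denominators of the claim have constant term 1, so their power series
    quotients agree with the quotients in the field.\<close>
  moreover have quot: "?\<phi> (f / g) = ?\<phi> f / ?\<phi> g" if "fps_nth g 0 = 1" for f g
  proof -
    have "g \<noteq> 0" using that by auto
    have "f / g * g = f"
      using that by (simp add: fps_divide_unit mult.assoc inverse_mult_eq_1)
    from div[OF this \<open>g \<noteq> 0\<close>] show ?thesis .
  qed
  ultimately have "?\<phi> (section_2_mod_5 F) = ?\<phi> (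
    3 * (euler_f 2 ^ 4 * euler_f 5 ^ 6 / (euler_f 1 ^ 8 * euler_f 10 ^ 2))
    + 8 * fps_X * (euler_f 2 ^ 3 * euler_f 5 * euler_f 10 ^ 3 / euler_f 1 ^ 7))"
    by (simp only: hom) (simp add: quot hom fps_power_zeroth euler_f_nth_0)
  then show ?thesis unfolding fps_to_fls_eq_iff .
qed

theorem theorem3p4:
  shows "Abs_fps (\<lambda>n. EO_u (10 * n + 4)) =
    3 * (euler_f 2 ^ 4 * euler_f 5 ^ 6 / (euler_f 1 ^ 8 * euler_f 10 ^ 2))
    + 8 * fps_X * (euler_f 2 ^ 3 * euler_f 5 * euler_f 10 ^ 3 / euler_f 1 ^ 7)"
proof -
  define F where "F = euler_f 2 ^ 2 * inverse (euler_f 1) ^ 2"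
  have F: "F * euler_f 1 ^ 2 = euler_f 2 ^ 2"
    by (simp add: F_def mult.assoc euler_f_nth_0 inverse_mult_eq_1 flip: power_mult_distrib)
  have "(F oo fps_X ^ 2) * euler_f 2 ^ 2 = euler_f 4 ^ 2"
    using arg_cong[OF F, of "\<lambda>f. f oo fps_X ^ 2"]
    by (simp add: fps_compose_mult_distrib euler_f_compose flip: fps_compose_power)
  then have "euler_f 4 ^ 2 / euler_f 2 ^ 2 = F oo fps_X ^ 2"
    by (metis euler_f_nonzero nonzero_mult_div_cancel_right power_not_zero zero_less_numeral)
  then have "EO_u (10 * n + 4) = fps_nth F (5 * n + 2)" for n
    by (simp add: EO_u_def fps_nth_compose_X_power)
  then have "Abs_fps (\<lambda>n. EO_u (10 * n + 4)) = section_2_mod_5 F"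
    by (simp add: section_2_mod_5_def)
  then show ?thesis using section_2_mod_5_quotient_eq[OF F] by simp
qed

end
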